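(* Let $n$ and $k$ be positive integers with $2k < n \le 70$. Then $i(n,k) < i(n,k+1)$ if and only if $$(n,k) \in \left\{ \begin{matrix} (30,9), (36,11), (39,12), (42,13), (45,14), (47,15), (48,15), \\ (51,16), (53,17), (54,17), (57,18), (59,19), (60,19), (63,20), \\ (64,21), (65,21), (66,21), (68,22), (69,22), (70,23) \end{matrix} \right\}.$$
   Context: For integers $n \ge k \ge 1$, the symmetric group $\mathrm{Sym}_n$ acts on the set of $k$-element subsets of $\{1,\ldots,n\}$. Let $i(n,k)$ be the proportion of permutations in $\mathrm{Sym}_n$ that fix (setwise) at least one $k$-subset of $\{1,\ldots,n\}$. *)

theory Defs
  imports Complex_Main "HOL-Combinatorics.Permutations"
begin

definition fixes_k_subset :: "nat \<Rightarrow> nat \<Rightarrow> (nat \<Rightarrow> nat) \<Rightarrow> bool" where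
  "fixes_k_subset n k p \<longleftrightarrow> (\<exists>S. S \<subseteq> {1..n} \<and> card S = k \<and> p ` S = S)"

definition i_prop :: "nat \<Rightarrow> nat \<Rightarrow> real" where
  "i_prop n k =
     real (card {p. p permutes {1..n} \<and> fixes_k_subset n k p}) /
     real (card {p. p permutes {1..n}})"

end

theory Submission
  imports Defs "HOL-Combinatorics.Orbits"
begin

text \<open>
  Cauchy's formula turns the proportion of permutations of an \<open>r\<close>-set with a prescribed
  cycle type into a product over the cycle lengths \<open>j\<close> of factors \<open>1 / (j^c * c!)\<close>, where \<open>c\<close> is
  the number of \<open>j\<close>-cycles. Whether a permutation fixes a \<open>k\<close>-subset depends only on the set \<open>S\<close> of
  sizes of unions of its cycles. So the cycles can be collected in order of increasing length,
  remembering only \<open>S\<close> and the number of points used so far, and \<open>i(n,k)\<close> becomes the outcome of a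
  dynamic program over such states. What makes this small enough is that once all cycles of length
  at most \<open>j\<close> are collected, only the part of \<open>S\<close> in \<open>{0..k-j-1}\<close> matters, since every further
  cycle adds more than \<open>j\<close>. The number of sets \<open>S\<close> peaks when \<open>j\<close> is about \<open>k/2\<close>, at a few thousand,
  although there are millions of cycle types.
  
  The statement is a comparison of about 1200 pairs of numbers. Nearly all of them differ by more
  than \<open>1.5 * 10^-4\<close>; the exceptions are \<open>i(58,19) - i(58,20)\<close>, about \<open>6 * 10^-7\<close>, and
  \<open>i(62,20) - i(62,21)\<close>, about \<open>5 * 10^-6\<close>. It therefore suffices to compute with integers that count
  multiples of a small unit and to round every division down. A single run produces lower bounds for
  the proportion of permutations that fix a \<open>k\<close>-set and for the proportion of those that do not,
  for all \<open>n\<close> at once; as these proportions add up to 1, \<open>i(n,k)\<close> is enclosed from both sides. For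
  \<open>n = 2k + 1\<close> the two sides of the comparison are equal, by passing to complements of subsets.
  
  The proof has three parts. \<open>card_long_perms\<close> is the counting: it identifies the proportion with
  a recursively defined number \<open>\<beta>\<close>, by double counting the pairs of a permutation and one of its
  shortest cycles. \<open>mass_run\<close> is the correctness of the dynamic program, which never
  overestimates the \<open>\<beta>\<close>-weighted sum of its states. The lemmas \<open>enclosure_1\<close>, \<open>enclosure_2\<close>, and so
  on run it by rewriting.
\<close>

section \<open>Permutations and their orbits\<close>

lemma permutes_glue:
  assumes "q permutes B" "r permutes C" "B \<inter> C = {}"
  shows "(\<lambda>x. if x \<in> B then q x else r x) permutes (B \<union> C)"
proof (rule bij_imp_permutes)
  have "bij_betw (\<lambda>x. if x \<in> B then q x else r x) B B"
    using permutes_imp_bij[OF assms(1)] by (subst bij_betw_cong[where g = q]) auto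
  moreover have "bij_betw (\<lambda>x. if x \<in> B then q x else r x) C C"
    using permutes_imp_bij[OF assms(2)] assms(3) by (subst bij_betw_cong[where g = r]) auto
  ultimately show "bij_betw (\<lambda>x. if x \<in> B then q x else r x) (B \<union> C) (B \<union> C)"
    by (rule bij_betw_combine) (use assms(3) in auto)
qed (use assms in \<open>auto simp: permutes_not_in\<close>)

lemma restrict_id_permutes:
  assumes "p permutes A" "p ` B = B"
  shows "restrict_id p B permutes B"
  using assms by (intro permutes_restrict_id) (metis bij_betw_def permutes_inj inj_on_subset subset_UNIV)

lemma image_Diff_invariant:
  assumes "p permutes A" "p ` B = B"
  shows "p ` (A - B) = A - B"
  using assms by (simp add: image_set_diff permutes_inj permutes_image)

text \<open>
  A permutation with an invariant subset \<open>B\<close> is a pair of permutations, one of \<open>B\<close> and one of the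
  rest. All counting below rests on this.
\<close>

lemma card_permutes_split:
  fixes A B :: "'a set"
  assumes "finite A" "B \<subseteq> A"
  shows "card {p. p permutes A \<and> p ` B = B \<and> Q (restrict_id p B) \<and> R (restrict_id p (A - B))}
       = card {q. q permutes B \<and> Q q} * card {r. r permutes (A - B) \<and> R r}"
proof -
  let ?f = "\<lambda>p. (restrict_id p B, restrict_id p (A - B))"
  let ?g = "\<lambda>(q,r) x. if x \<in> B then q x else r x"
  have "bij_betw ?f {p. p permutes A \<and> p ` B = B \<and> Q (restrict_id p B) \<and> R (restrict_id p (A - B))}
      ({q. q permutes B \<and> Q q} \<times> {r. r permutes (A - B) \<and> R r})"
  proof (rule bij_betw_byWitness[where f' = ?g])
    have "?g (?f p) = p" if "p permutes A" for p
      using that by (auto simp: fun_eq_iff restrict_id_def permutes_not_in)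
    thus "\<forall>p\<in>{p. p permutes A \<and> p ` B = B \<and> Q (restrict_id p B) \<and> R (restrict_id p (A - B))}. ?g (?f p) = p"
      by blast
    have inv: "restrict_id (?g (q,r)) B = q" "restrict_id (?g (q,r)) (A - B) = r"
      if "q permutes B" "r permutes A - B" for q r
      using that by (auto simp: fun_eq_iff restrict_id_def permutes_not_in)
    thus "\<forall>x\<in>{q. q permutes B \<and> Q q} \<times> {r. r permutes A - B \<and> R r}. ?f (?g x) = x"
      by auto
    show "?f ` {p. p permutes A \<and> p ` B = B \<and> Q (restrict_id p B) \<and> R (restrict_id p (A - B))}
        \<subseteq> {q. q permutes B \<and> Q q} \<times> {r. r permutes (A - B) \<and> R r}"
      using restrict_id_permutes[of _ A B] restrict_id_permutes[OF _ image_Diff_invariant, of _ A A B]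
      by (intro image_subsetI) simp
    have glue: "?g (q,r) permutes A \<and> ?g (q,r) ` B = B" if "q permutes B" "r permutes A - B" for q r
    proof -
      have "B \<union> (A - B) = A" using assms by auto
      moreover have "?g (q,r) ` B = q ` B" by auto
      ultimately show ?thesis
        using permutes_glue[OF that] permutes_image[OF that(1)] by auto
    qed
    show "?g ` ({q. q permutes B \<and> Q q} \<times> {r. r permutes (A - B) \<and> R r})
        \<subseteq> {p. p permutes A \<and> p ` B = B \<and> Q (restrict_id p B) \<and> R (restrict_id p (A - B))}"
    proof (rule image_subsetI)
      fix z assume "z \<in> {q. q permutes B \<and> Q q} \<times> {r. r permutes (A - B) \<and> R r}"
      then obtain q r where z: "z = (q,r)" and *: "q permutes B" "Q q" "r permutes A - B" "R r" by blast
      have "?g (q,r) permutes A \<and> ?g (q,r) ` B = B \<and> Q (restrict_id (?g (q,r)) B) \<and> R (restrict_id (?g (q,r)) (A - B))"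
        using glue[OF *(1,3)] unfolding inv(1)[OF *(1,3)] inv(2)[OF *(1,3)] using * by blast
      thus "?g z \<in> {p. p permutes A \<and> p ` B = B \<and> Q (restrict_id p B) \<and> R (restrict_id p (A - B))}"
        unfolding z by blast
    qed
  qed
  from bij_betw_same_card[OF this] show ?thesis by (simp add: card_cartesian_product)
qed

lemma orbit_restrict_id:
  assumes "p ` B = B" "x \<in> B"
  shows "orbit (restrict_id p B) x = orbit p x"
  using assms by (intro orbit_cong0[of _ B]) auto

lemma self_in_orbit:
  assumes "p permutes A" "finite A" shows "x \<in> orbit p x"
  by (rule permutation_self_in_orbit[OF permutes_imp_permutation[OF assms(2,1)]])

lemma orbit_invariant:
  assumes "p permutes A" "finite A" shows "p ` orbit p x = orbit p x"
proof -
  have "y \<in> p ` orbit p x" if "y \<in> orbit p x" for y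
    using that by cases (use self_in_orbit[OF assms, of x] in auto)
  thus ?thesis by (auto intro: orbit.step)
qed

lemma orbit_least:
  assumes "p ` D = D" "x \<in> D" shows "orbit p x \<subseteq> D"
proof
  fix y assume "y \<in> orbit p x" thus "y \<in> D" by induction (use assms in auto)
qed

lemma orbit_eq:
  assumes "p permutes A" "finite A" "y \<in> orbit p x" shows "orbit p y = orbit p x"
proof -
  have "x \<in> orbit p y" by (rule orbit_swap[OF self_in_orbit[OF assms(1,2)] assms(3)])
  thus ?thesis using assms(3) by (blast intro: orbit_trans)
qed

definition cycles :: "'a set \<Rightarrow> ('a \<Rightarrow> 'a) set" where
  "cycles B = {q. q permutes B \<and> (\<forall>x\<in>B. orbit q x = B)}"

lemma orbit_eq_iff_cycle:
  assumes "p permutes A" "finite A" "x \<in> B" 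
  shows "orbit p x = B \<longleftrightarrow> p ` B = B \<and> (\<forall>y\<in>B. orbit (restrict_id p B) y = B)"
proof
  assume *: "orbit p x = B"
  have "p ` B = B" using orbit_invariant[OF assms(1,2)] * by metis
  moreover have "orbit p y = B" if "y \<in> B" for y
    using orbit_eq[OF assms(1,2)] that * by metis
  ultimately show "p ` B = B \<and> (\<forall>y\<in>B. orbit (restrict_id p B) y = B)"
    by (simp add: orbit_restrict_id)
next
  assume "p ` B = B \<and> (\<forall>y\<in>B. orbit (restrict_id p B) y = B)"
  thus "orbit p x = B" using assms(3) by (metis orbit_restrict_id)
qed

lemma card_orbit_eq:
  assumes "finite A" "B \<subseteq> A" "x \<in> B"
  shows "card {p. p permutes A \<and> orbit p x = B} = card (cycles B) * fact (card A - card B)"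
proof -
  have "{p. p permutes A \<and> orbit p x = B} = {p. p permutes A \<and> p ` B = B \<and> (\<forall>y\<in>B. orbit (restrict_id p B) y = B) \<and> True}"
    using orbit_eq_iff_cycle[OF _ assms(1,3)] by blast
  also have "card \<dots> = card (cycles B) * card {r. r permutes (A - B) \<and> True}"
    unfolding cycles_def by (rule card_permutes_split[OF assms(1,2)])
  also have "card {r. r permutes (A - B) \<and> True} = fact (card A - card B)"
    using assms by (simp add: card_permutations card_Diff_subset finite_subset)
  finally show ?thesis .
qed

lemma sum_Pow_card:
  fixes f :: "nat \<Rightarrow> 'b::comm_semiring_1"
  assumes "finite A"
  shows "(\<Sum>D\<in>Pow A. f (card D)) = (\<Sum>i\<le>card A. of_nat (card A choose i) * f i)"
proof -
  have "(\<Sum>D\<in>Pow A. f (card D)) = (\<Sum>i\<in>{..card A}. \<Sum>D | D \<in> Pow A \<and> card D = i. f (card D))"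
    by (rule sum.group[symmetric]) (use assms in \<open>auto intro: card_mono\<close>)
  also have "\<dots> = (\<Sum>i\<le>card A. of_nat (card A choose i) * f i)"
    using n_subsets[OF assms] by (intro sum.cong) (auto simp: Pow_def)
  finally show ?thesis .
qed

text \<open>
  Splitting the \<open>r!\<close> permutations according to the orbit of a fixed point \<open>x\<close> gives one summand for
  each orbit size, and by induction every summand except that for the full orbit equals \<open>(r-1)!\<close>.
  This leaves \<open>(r-1)!\<close> for the permutations with a single orbit.
\<close>

lemma card_cycles:
  assumes "finite B" "B \<noteq> {}"
  shows "card (cycles B) = fact (card B - 1)"
  using assms
proof (induction "card B" arbitrary: B rule: less_induct)
  case less
  then obtain x where x: "x \<in> B" by blast
  define B' where "B' = B - {x}"
  have B: "B = insert x B'" "x \<notin> B'" "finite B'" using x less.prems by (auto simp: B'_def)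
  define m where "m = card B'"
  have cB: "card B = Suc m" using B by (simp add: m_def)
  have "{p. p permutes B} = (\<Union>D\<in>Pow B'. {p. p permutes B \<and> orbit p x = insert x D})" (is "_ = ?U")
  proof -
    have "p \<in> ?U" if "p permutes B" for p
    proof -
      have "orbit p x \<subseteq> B" using orbit_least permutes_image that x by metis
      moreover have "x \<in> orbit p x" using self_in_orbit[OF that less.prems(1)] .
      ultimately have "orbit p x - {x} \<in> Pow B'" "orbit p x = insert x (orbit p x - {x})" by (auto simp: B'_def)
      thus ?thesis using that by blast
    qed
    thus ?thesis by auto
  qed
  hence "fact (card B) = card ?U" using card_permutations[OF refl less.prems(1)] by metis
  also have "\<dots> = (\<Sum>D\<in>Pow B'. card {p. p permutes B \<and> orbit p x = insert x D})"
  proof (rule card_UN_disjoint)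
    show "\<forall>D\<in>Pow B'. finite {p. p permutes B \<and> orbit p x = insert x D}"
      using finite_permutations[OF less.prems(1)] by auto
    have "D = D'" if "insert x D = insert x D'" "D \<in> Pow B'" "D' \<in> Pow B'" for D D'
      using that B(2) by (metis Pow_iff insert_ident subsetD)
    hence "insert x D \<noteq> insert x D'" if "D \<in> Pow B'" "D' \<in> Pow B'" "D \<noteq> D'" for D D'
      using that by metis
    thus "\<forall>D\<in>Pow B'. \<forall>D'\<in>Pow B'. D \<noteq> D' \<longrightarrow> {p. p permutes B \<and> orbit p x = insert x D} \<inter> {p. p permutes B \<and> orbit p x = insert x D'} = {}"
      by (intro ballI impI) (simp add: disjoint_iff)
  qed (use B in auto)
  also have "\<dots> = (\<Sum>D\<in>Pow B'. card (cycles (insert x D)) * fact (m - card D))"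
  proof (rule sum.cong[OF refl])
    fix D assume D: "D \<in> Pow B'"
    hence "card (insert x D) = Suc (card D)" using B finite_subset by (subst card_insert_disjoint) auto
    thus "card {p. p permutes B \<and> orbit p x = insert x D} = card (cycles (insert x D)) * fact (m - card D)"
      using card_orbit_eq[OF less.prems(1), of "insert x D" x] D B(1) cB by auto
  qed
  also have "Pow B' = insert B' (Pow B' - {B'})" by auto
  also have "(\<Sum>D\<in>insert B' (Pow B' - {B'}). card (cycles (insert x D)) * fact (m - card D))
      = card (cycles B) + (\<Sum>D\<in>Pow B' - {B'}. card (cycles (insert x D)) * fact (m - card D))"
    using B by (subst sum.insert) (auto simp: m_def)
  also have "(\<Sum>D\<in>Pow B' - {B'}. card (cycles (insert x D)) * fact (m - card D))
      = (\<Sum>D\<in>Pow B' - {B'}. fact (card D) * fact (m - card D))"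
  proof (rule sum.cong[OF refl])
    fix D assume D: "D \<in> Pow B' - {B'}"
    hence fD: "finite D" "x \<notin> D" using B finite_subset by auto
    have "card D < card B'" using D B(3) by (intro psubset_card_mono) auto
    hence "card (cycles (insert x D)) = fact (card D)"
      using less.hyps[of "insert x D"] fD cB by (auto simp: m_def)
    thus "card (cycles (insert x D)) * fact (m - card D) = fact (card D) * fact (m - card D)" by simp
  qed
  also have "\<dots> = (\<Sum>D\<in>Pow B'. fact (card D) * fact (m - card D)) - fact m"
    using B by (subst sum_diff1_nat) (auto simp: m_def)
  also have "(\<Sum>D\<in>Pow B'. fact (card D) * fact (m - card D)) = (\<Sum>i\<le>m. (m choose i) * (fact i * fact (m - i)))"
    using sum_Pow_card[OF B(3), of "\<lambda>i. fact i * fact (m - i) :: nat"] by (simp add: m_def)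
  also have "\<dots> = (\<Sum>i\<le>m. fact m)"
    by (intro sum.cong refl) (metis atMost_iff binomial_fact_lemma mult.assoc mult.commute)
  finally have "fact (Suc m) = card (cycles B) + (Suc m * fact m - fact m)" by (simp add: cB)
  thus ?case by (simp add: cB)
qed

section \<open>Counting permutations by their shortest cycles\<close>

text \<open>
  \<open>S\<close> holds the subset sums of the cycles that were removed already, and \<open>A\<close> is the set of points
  that remain. A permutation of \<open>A\<close> is a hit if it completes one of these sums to \<open>k\<close>.
\<close>

definition hits :: "nat \<Rightarrow> nat set \<Rightarrow> ('a \<Rightarrow> 'a) \<Rightarrow> 'a set \<Rightarrow> bool" where
  "hits k S p A \<longleftrightarrow> (\<exists>D\<subseteq>A. p ` D = D \<and> (\<exists>s\<in>S. s + card D = k))"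

text \<open>
  The effect on the subset sums of one more cycle of length \<open>j\<close>.
\<close>

definition extend :: "nat \<Rightarrow> nat set \<Rightarrow> nat set" where
  "extend j S = S \<union> (\<lambda>s. s + j) ` S"

definition orbits :: "nat \<Rightarrow> ('a \<Rightarrow> 'a) \<Rightarrow> 'a set \<Rightarrow> 'a set set" where
  "orbits j p A = {B. card B = j \<and> (\<exists>x\<in>A. B = orbit p x)}"

text \<open>
  The boolean \<open>h\<close> selects the hits or the misses. Both are counted by the same recurrence, and
  carrying \<open>h\<close> along spares a second copy of every argument.
\<close>

definition long_perms :: "nat \<Rightarrow> nat \<Rightarrow> nat set \<Rightarrow> bool \<Rightarrow> 'a set \<Rightarrow> ('a \<Rightarrow> 'a) set" where
  "long_perms k j S h A = {p. p permutes A \<and> (\<forall>x\<in>A. j \<le> card (orbit p x)) \<and> hits k S p A = h}"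

text \<open>
  An invariant set contains the orbit \<open>B\<close> or is disjoint from it, so removing \<open>B\<close> changes
  the reachable sizes exactly as \<open>extend\<close> says.
\<close>

lemma
  fixes p :: "'a \<Rightarrow> 'a"
  assumes p: "p permutes A" "finite A" and B: "B \<subseteq> A" "p ` B = B" "B \<noteq> {}" "\<forall>y\<in>B. orbit (restrict_id p B) y = B" "card B = j"
  defines "r \<equiv> restrict_id p (A - B)"
  shows remove_orbit_long: "(\<forall>x\<in>A. j \<le> card (orbit p x)) \<longleftrightarrow> (\<forall>x\<in>A-B. j \<le> card (orbit r x))"
    and remove_orbit_orbits: "orbits j p A = insert B (orbits j r (A - B))" "B \<notin> orbits j r (A - B)"
    and remove_orbit_hits: "hits k S p A \<longleftrightarrow> hits k (extend j S) r (A - B)"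
proof -
  have C: "p ` (A - B) = A - B" using image_Diff_invariant[OF p(1) B(2)] .
  have o1: "orbit r x = orbit p x" if "x \<in> A - B" for x
    using orbit_restrict_id[OF C that] by (simp add: r_def)
  have o2: "orbit p x = B" if "x \<in> B" for x
    using orbit_restrict_id[OF B(2) that] B(4) that by simp
  show "(\<forall>x\<in>A. j \<le> card (orbit p x)) \<longleftrightarrow> (\<forall>x\<in>A-B. j \<le> card (orbit r x))"
    using o1 o2 B(5) by (metis Diff_iff order_refl)
  have "orbits j r (A - B) = {D. card D = j \<and> (\<exists>x\<in>A-B. D = orbit p x)}"
    unfolding orbits_def using o1 by (metis (no_types, opaque_lifting))
  moreover have "orbits j p A = {D. card D = j \<and> (\<exists>x\<in>A-B. D = orbit p x)} \<union> {D. card D = j \<and> (\<exists>x\<in>B. D = orbit p x)}"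
    unfolding orbits_def using B(1) by blast
  moreover have "{D. card D = j \<and> (\<exists>x\<in>B. D = orbit p x)} = {B}"
    using o2 B(3,5) by auto
  ultimately show "orbits j p A = insert B (orbits j r (A - B))" by simp
  show "B \<notin> orbits j r (A - B)"
  proof
    assume "B \<in> orbits j r (A - B)"
    then obtain x where x: "x \<in> A - B" "B = orbit p x" unfolding orbits_def using o1 by auto
    thus False using self_in_orbit[OF p, of x] by simp
  qed
  have rp: "r ` D = p ` D" if "D \<subseteq> A - B" for D
    unfolding r_def restrict_id_def using that by (intro image_cong) auto
  have finA: "finite D" if "D \<subseteq> A" for D using that p(2) finite_subset by blast
  show "hits k S p A \<longleftrightarrow> hits k (extend j S) r (A - B)"
  proof
    assume "hits k S p A"
    then obtain D s where D: "D \<subseteq> A" "p ` D = D" "s \<in> S" "s + card D = k" unfolding hits_def by blast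
    have inv: "p ` (D - B) = D - B"
      using D(2) B(2) by (metis image_set_diff p(1) permutes_inj)
    have r: "r ` (D - B) = D - B" using inv rp[of "D - B"] D(1) by auto
    show "hits k (extend j S) r (A - B)"
    proof (cases "D \<inter> B = {}")
      case True
      hence "D - B = D" by blast
      thus ?thesis unfolding hits_def extend_def using D r by (intro exI[of _ D]) auto
    next
      case False
      then obtain x where "x \<in> D" "x \<in> B" by blast
      hence "B \<subseteq> D" using orbit_least[OF D(2)] o2 by metis
      hence "card (D - B) + j = card D"
        using B(5) finA[OF D(1)] by (metis card_Diff_subset card_mono finite_subset le_add_diff_inverse2)
      hence "(s + j) + card (D - B) = k" using D(4) by linarith
      moreover have "s + j \<in> extend j S" using D(3) by (simp add: extend_def)
      ultimately show ?thesis unfolding hits_def using r D(1) by (intro exI[of _ "D - B"]) blast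
    qed
  next
    assume "hits k (extend j S) r (A - B)"
    then obtain D t where D: "D \<subseteq> A - B" "r ` D = D" "t \<in> extend j S" "t + card D = k" unfolding hits_def by blast
    have pD: "p ` D = D" using rp[OF D(1)] D(2) by simp
    from D(3) consider "t \<in> S" | s where "s \<in> S" "t = s + j" by (auto simp: extend_def)
    thus "hits k S p A"
    proof cases
      case 1 thus ?thesis unfolding hits_def using D pD by (intro exI[of _ D]) auto
    next
      case 2
      have "D \<inter> B = {}" "finite D" "finite B" using D(1) B(1) finA[of D] finA[of B] by auto
      hence "card (D \<union> B) = card D + j"
        using B(5) by (simp add: card_Un_disjoint)
      moreover have "p ` (D \<union> B) = D \<union> B" using pD B(2) by (simp add: image_Un)
      ultimately show ?thesis unfolding hits_def using 2 D(1,4) B(1)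
        by (intro exI[of _ "D \<union> B"] conjI bexI[of _ s]) auto
    qed
  qed
qed

lemma long_perms_remove_orbit:
  fixes A :: "'a set"
  assumes "finite A" "B \<subseteq> A" "card B = j" "j > 0"
  shows "card {p \<in> long_perms k j S h A. card (orbits j p A) = Suc c \<and> B \<in> orbits j p A}
       = fact (j - 1) * card {p \<in> long_perms k j (extend j S) h (A - B). card (orbits j p (A - B)) = c}"
proof -
  have "card B > 0" using assms(3,4) by simp
  hence fB: "finite B" "B \<noteq> {}" by (simp_all add: card_gt_0_iff)
  have fin: "finite (orbits j p C)" if "finite C" for p and C :: "'a set"
    using that by (intro finite_subset[of "orbits j p C" "orbit p ` C"]) (auto simp: orbits_def)
  define Q where "Q = (\<lambda>q. \<forall>y\<in>B. orbit q y = B)"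
  define R where "R = (\<lambda>r. (\<forall>x\<in>A-B. j \<le> card (orbit r x)) \<and> hits k (extend j S) r (A - B) = h \<and> card (orbits j r (A - B)) = c)"
  have *: "B \<in> orbits j p A \<longleftrightarrow> p ` B = B \<and> Q (restrict_id p B)" if p: "p permutes A" for p
  proof -
    obtain b where b: "b \<in> B" using fB by blast
    have "B \<in> orbits j p A \<longleftrightarrow> (\<exists>x\<in>A. orbit p x = B)" using assms(3) by (auto simp: orbits_def)
    also have "\<dots> \<longleftrightarrow> orbit p b = B"
      using orbit_eq[OF p assms(1)] b assms(2) by blast
    finally show ?thesis using orbit_eq_iff_cycle[OF p assms(1) b] by (simp add: Q_def)
  qed
  have "{p \<in> long_perms k j S h A. card (orbits j p A) = Suc c \<and> B \<in> orbits j p A}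
      = {p. p permutes A \<and> p ` B = B \<and> Q (restrict_id p B) \<and> R (restrict_id p (A - B))}"
  proof (rule Collect_cong)
    fix p
    show "(p \<in> long_perms k j S h A \<and> card (orbits j p A) = Suc c \<and> B \<in> orbits j p A) =
      (p permutes A \<and> p ` B = B \<and> Q (restrict_id p B) \<and> R (restrict_id p (A - B)))"
    proof (cases "p permutes A \<and> p ` B = B \<and> Q (restrict_id p B)")
      case False thus ?thesis using * by (auto simp: long_perms_def)
    next
      case True
      note r = True[THEN conjunct1] assms(1,2) True[THEN conjunct2, THEN conjunct1] fB(2)
        True[THEN conjunct2, THEN conjunct2, unfolded Q_def] assms(3)
      have "card (orbits j p A) = Suc (card (orbits j (restrict_id p (A - B)) (A - B)))"
        unfolding remove_orbit_orbits(1)[OF r] using remove_orbit_orbits(2)[OF r] fin assms(1) by simp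
      thus ?thesis using True *[of p] remove_orbit_long[OF r] remove_orbit_hits[OF r]
        by (simp add: long_perms_def R_def)
    qed
  qed
  also have "card \<dots> = card {q. q permutes B \<and> Q q} * card {r. r permutes (A - B) \<and> R r}"
    by (rule card_permutes_split[OF assms(1,2)])
  also have "{q. q permutes B \<and> Q q} = cycles B" by (simp add: cycles_def Q_def)
  also have "card \<dots> = fact (j - 1)" using card_cycles[OF fB] assms(3) by simp
  also have "{r. r permutes (A - B) \<and> R r} = {p \<in> long_perms k j (extend j S) h (A - B). card (orbits j p (A - B)) = c}"
    by (auto simp: long_perms_def R_def)
  finally show ?thesis .
qed

lemma finite_long_perms: "finite A \<Longrightarrow> finite (long_perms k j S h A)"
  unfolding long_perms_def using finite_permutations[of A] by (rule rev_finite_subset) auto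

text \<open>
  Double counting of the pairs of a permutation with \<open>Suc c\<close> orbits of size \<open>j\<close> and one of these
  orbits. Removing a single orbit at a time avoids any count of permutations of type \<open>j^c\<close>, and it is
  also how the dynamic program proceeds.
\<close>

lemma long_perms_recurrence:
  assumes "finite A" "j > 0"
  shows "Suc c * card {p \<in> long_perms k j S h A. card (orbits j p A) = Suc c}
      = (\<Sum>B | B \<subseteq> A \<and> card B = j. fact (j - 1) * card {p \<in> long_perms k j (extend j S) h (A - B). card (orbits j p (A - B)) = c})"
proof -
  let ?X = "{p \<in> long_perms k j S h A. card (orbits j p A) = Suc c}"
  let ?Y = "{B. B \<subseteq> A \<and> card B = j}"
  have fX: "finite ?X" using finite_long_perms[OF assms(1)] by simp
  have fY: "finite ?Y" using assms(1) by simp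
  have "Suc c * card ?X = (\<Sum>p\<in>?X. card {B\<in>?Y. B \<in> orbits j p A})"
  proof -
    have "{B\<in>?Y. B \<in> orbits j p A} = orbits j p A" if "p \<in> ?X" for p
    proof -
      have "p permutes A" using that by (simp add: long_perms_def)
      hence "orbit p x \<subseteq> A" if "x \<in> A" for x using that orbit_least[OF permutes_image] by metis
      thus ?thesis by (auto simp: orbits_def)
    qed
    thus ?thesis by simp
  qed
  also have "\<dots> = (\<Sum>p\<in>?X. \<Sum>B\<in>?Y. if B \<in> orbits j p A then 1 else 0)"
    using fY by (simp add: sum.If_cases Int_def)
  also have "\<dots> = (\<Sum>B\<in>?Y. \<Sum>p\<in>?X. if B \<in> orbits j p A then 1 else 0)" by (rule sum.swap)
  also have "\<dots> = (\<Sum>B\<in>?Y. card {p\<in>?X. B \<in> orbits j p A})"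
    using fX by (simp add: sum.If_cases Int_def)
  also have "\<dots> = (\<Sum>B\<in>?Y. fact (j - 1) * card {p \<in> long_perms k j (extend j S) h (A - B). card (orbits j p (A - B)) = c})"
  proof (rule sum.cong[OF refl])
    fix B assume "B \<in> ?Y"
    thus "card {p\<in>?X. B \<in> orbits j p A} = fact (j - 1) * card {p \<in> long_perms k j (extend j S) h (A - B). card (orbits j p (A - B)) = c}"
      using long_perms_remove_orbit[of A B j k S h c] assms by (simp add: conj_assoc)
  qed
  finally show ?thesis .
qed

text \<open>
  \<open>\<beta> k h j r S\<close> is the proportion, among all permutations of an \<open>r\<close>-set, of those whose cycles all
  have length at least \<open>j\<close> and that hit (\<open>h = True\<close>) or miss (\<open>h = False\<close>) given the sums \<open>S\<close>; the
  variant \<open>\<alpha>\<close> fixes the number \<open>c\<close> of \<open>j\<close>-cycles. Defining them by recursion and not as cardinalities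
  makes it evident that the points themselves are irrelevant.
\<close>

function \<beta> :: "nat \<Rightarrow> bool \<Rightarrow> nat \<Rightarrow> nat \<Rightarrow> nat set \<Rightarrow> real" where
  "\<beta> k h j r S =
    (if r = 0 then of_bool ((k \<in> S) = h)
     else if r < j \<or> j = 0 then 0
     else (\<Sum>c\<le>r div j. \<beta> k h (Suc j) (r - c * j) ((extend j ^^ c) S) / (real j ^ c * fact c)))"
  by pat_completeness auto
termination
  by (relation "measure (\<lambda>(k,h,j,r,S). Suc r - j)") (auto simp: not_less)
declare \<beta>.simps [simp del]

definition \<alpha> :: "nat \<Rightarrow> bool \<Rightarrow> nat \<Rightarrow> nat \<Rightarrow> nat \<Rightarrow> nat set \<Rightarrow> real" where
  "\<alpha> k h j c r S = (if c * j \<le> r then \<beta> k h (Suc j) (r - c * j) ((extend j ^^ c) S) / (real j ^ c * fact c) else 0)"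

lemma \<alpha>_0: "\<alpha> k h j 0 r S = \<beta> k h (Suc j) r S"
  by (simp add: \<alpha>_def)

lemma \<alpha>_Suc:
  "\<alpha> k h j (Suc c) r S = (if j \<le> r then \<alpha> k h j c (r - j) (extend j S) / (real j * real (Suc c)) else 0)"
  by (auto simp: \<alpha>_def funpow_swap1 mult_ac)

lemma \<beta>_eq_sum_\<alpha>:
  assumes "j > 0"
  shows "\<beta> k h j r S = (\<Sum>c\<le>r. \<alpha> k h j c r S)"
proof -
  have *: "c \<le> r div j \<longleftrightarrow> c * j \<le> r" for c using assms by (simp add: less_eq_div_iff_mult_less_eq)
  have "(\<Sum>c\<le>r. \<alpha> k h j c r S) = (\<Sum>c\<le>r div j. \<alpha> k h j c r S)"
    by (rule sum.mono_neutral_right) (auto simp: \<alpha>_def *)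
  also have "\<dots> = \<beta> k h j r S"
  proof (cases "r = 0 \<or> r < j")
    case True thus ?thesis using assms by (auto simp: \<alpha>_def \<beta>.simps)
  next
    case False thus ?thesis using assms * unfolding \<beta>.simps[of k h j r S] by (auto simp: \<alpha>_def intro!: sum.cong)
  qed
  finally show ?thesis by simp
qed

lemma card_long_perms:
  fixes A :: "'a set"
  assumes "finite A" "j > 0"
  shows "real (card (long_perms k j S h A)) = fact (card A) * \<beta> k h j (card A) S"
  using assms
proof (induction "Suc (card A) - j" arbitrary: A j S rule: less_induct)
  case less
  have IH: "real (card (long_perms k (Suc j) S h C)) = fact (card C) * \<beta> k h (Suc j) (card C) S"
    if "finite C" "card C \<le> card A" "j \<le> card A" for C :: "'a set" and S
    using less.hyps[of C "Suc j" S] that by simp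
  show ?case
  proof (cases "card A < j")
    case True
    show ?thesis
    proof (cases "A = {}")
      case True
      hence "long_perms k j S h A = (if (k \<in> S) = h then {id} else {})"
        by (auto simp: long_perms_def hits_def)
      thus ?thesis using True by (simp add: \<beta>.simps)
    next
      case False
      then obtain x where "x \<in> A" by blast
      hence "card (orbit p x) \<le> card A" if "p permutes A" for p
        using orbit_least[OF permutes_image[OF that] \<open>x \<in> A\<close>] less.prems(1) by (simp add: card_mono)
      hence "long_perms k j S h A = {}" using \<open>x \<in> A\<close> \<open>card A < j\<close> by (force simp: long_perms_def)
      thus ?thesis using False True less.prems by (simp add: \<beta>.simps)
    qed
  next
    case False
    have "real (card {p \<in> long_perms k j S h C. card (orbits j p C) = c}) = fact (card C) * \<alpha> k h j c (card C) S"
      if "finite C" "card C \<le> card A" for c S and C :: "'a set"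
      using that
    proof (induction c arbitrary: C S)
      case 0
      have "{p \<in> long_perms k j S h C. card (orbits j p C) = 0} = long_perms k (Suc j) S h C"
      proof -
        have "card (orbits j p C) = 0 \<longleftrightarrow> (\<forall>x\<in>C. card (orbit p x) \<noteq> j)" for p
        proof -
          have "finite (orbits j p C)"
            using 0 by (intro finite_subset[of "orbits j p C" "orbit p ` C"]) (auto simp: orbits_def)
          hence "card (orbits j p C) = 0 \<longleftrightarrow> orbits j p C = {}" by (simp add: card_eq_0_iff)
          thus ?thesis unfolding orbits_def by blast
        qed
        moreover have "Suc j \<le> m \<longleftrightarrow> j \<le> m \<and> m \<noteq> j" for m by auto
        ultimately show ?thesis unfolding long_perms_def by blast
      qed
      thus ?case using IH[of C S] 0 False by (simp add: \<alpha>_0)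
    next
      case (Suc c)
      let ?n = "card C"
      show ?case
      proof (cases "j \<le> ?n")
        case True
        have "real (Suc c) * real (card {p \<in> long_perms k j S h C. card (orbits j p C) = Suc c})
           = real (\<Sum>B | B \<subseteq> C \<and> card B = j. fact (j - 1) * card {p \<in> long_perms k j (extend j S) h (C - B). card (orbits j p (C - B)) = c})"
          by (simp only: of_nat_mult[symmetric] long_perms_recurrence[OF Suc.prems(1) less.prems(2)])
        also have "\<dots> = (\<Sum>B | B \<subseteq> C \<and> card B = j. fact (j - 1) * (fact (?n - j) * \<alpha> k h j c (?n - j) (extend j S)))"
          unfolding of_nat_sum
        proof (rule sum.cong[OF refl])
          fix B assume "B \<in> {B. B \<subseteq> C \<and> card B = j}"
          hence "finite (C - B)" "card (C - B) = ?n - j" using Suc.prems(1) by (auto simp: card_Diff_subset finite_subset)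
          thus "real (fact (j - 1) * card {p \<in> long_perms k j (extend j S) h (C - B). card (orbits j p (C - B)) = c})
            = fact (j - 1) * (fact (?n - j) * \<alpha> k h j c (?n - j) (extend j S))"
            using Suc.IH[of "C - B" "extend j S"] Suc.prems(2) by simp
        qed
        also have "\<dots> = real (?n choose j) * (fact (j - 1) * (fact (?n - j) * \<alpha> k h j c (?n - j) (extend j S)))"
          using n_subsets[OF Suc.prems(1)] by simp
        also have "\<dots> = fact ?n * (\<alpha> k h j c (?n - j) (extend j S) / real j)"
        proof -
          have "fact j = real j * fact (j - 1)" using less.prems(2) by (simp add: fact_reduce)
          thus ?thesis using binomial_fact[OF True, where 'a = real] by (simp add: field_simps)
        qed
        finally have eq: "real (Suc c) * real (card {p \<in> long_perms k j S h C. card (orbits j p C) = Suc c})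
            = fact ?n * (\<alpha> k h j c (?n - j) (extend j S) / real j)" .
        have *: "x = fact ?n * (a / (real j * real (Suc c)))" if "real (Suc c) * x = fact ?n * (a / real j)" for x a :: real
        proof -
          have "x = (real (Suc c) * x) / real (Suc c)" by simp
          thus ?thesis unfolding that by (simp del: of_nat_Suc)
        qed
        show ?thesis using True *[OF eq] by (simp only: \<alpha>_Suc if_True)
      next
        case False
        have "{B. B \<subseteq> C \<and> card B = j} = {}"
          using False Suc.prems(1) card_mono by (metis (mono_tags, lifting) Collect_empty_eq)
        hence "Suc c * card {p \<in> long_perms k j S h C. card (orbits j p C) = Suc c} = 0"
          using long_perms_recurrence[OF Suc.prems(1) less.prems(2), of c k S h] by (simp only: sum.empty)
        hence "card {p \<in> long_perms k j S h C. card (orbits j p C) = Suc c} = 0" by simp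
        thus ?thesis using False by (simp only: \<alpha>_Suc if_False of_nat_0 mult_zero_right)
      qed
    qed
    note class_card = this
    have "long_perms k j S h A = (\<Union>c\<in>{..card A}. {p \<in> long_perms k j S h A. card (orbits j p A) = c})"
    proof -
      have "card (orbits j p A) \<le> card A" for p
      proof -
        have "orbits j p A \<subseteq> orbit p ` A" by (auto simp: orbits_def)
        hence "card (orbits j p A) \<le> card (orbit p ` A)" using less.prems(1) by (intro card_mono) auto
        thus ?thesis using card_image_le[OF less.prems(1), of "orbit p"] by linarith
      qed
      thus ?thesis by auto
    qed
    hence "card (long_perms k j S h A) = card (\<Union>c\<in>{..card A}. {p \<in> long_perms k j S h A. card (orbits j p A) = c})" by simp
    also have "\<dots> = (\<Sum>c\<le>card A. card {p \<in> long_perms k j S h A. card (orbits j p A) = c})"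
      by (rule card_UN_disjoint) (use finite_long_perms[OF less.prems(1), of k j S h] in auto)
    finally show ?thesis
      using class_card[OF less.prems(1) order_refl] by (simp add: \<beta>_eq_sum_\<alpha>[OF less.prems(2)] sum_distrib_left)
  qed
qed

text \<open>
  When all remaining cycles have length at least \<open>j\<close>, a sum \<open>s\<close> can still lead to \<open>k\<close> only if
  \<open>s + j \<le> k\<close> or \<open>s = k\<close>. States that agree on these sums can be merged.
\<close>

definition relevant :: "nat \<Rightarrow> nat \<Rightarrow> nat set \<Rightarrow> nat set \<Rightarrow> bool" where
  "relevant k j S S' \<longleftrightarrow> (\<forall>s. s + j \<le> k \<or> s = k \<longrightarrow> (s \<in> S \<longleftrightarrow> s \<in> S'))"

lemma relevant_extend:
  assumes "relevant k j S S'" shows "relevant k j (extend j S) (extend j S')"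
proof -
  have e: "s \<in> extend j T \<longleftrightarrow> s \<in> T \<or> (j \<le> s \<and> s - j \<in> T)" for s T
    by (force simp: extend_def)
  show ?thesis using assms unfolding relevant_def e by auto
qed

lemma relevant_extend_funpow:
  assumes "relevant k j S S'" shows "relevant k j ((extend j ^^ c) S) ((extend j ^^ c) S')"
  using assms by (induction c) (auto intro: relevant_extend)

lemma relevant_Suc: "relevant k j S S' \<Longrightarrow> relevant k (Suc j) S S'"
  by (auto simp: relevant_def)

lemma \<beta>_relevant:
  assumes "relevant k j S S'" shows "\<beta> k h j r S = \<beta> k h j r S'"
  using assms
proof (induction k h j r S arbitrary: S' rule: \<beta>.induct)
  case (1 k h j r S)
  note rel = relevant_Suc[OF relevant_extend_funpow[OF 1(2)]]
  have "\<beta> k h (Suc j) (r - c * j) ((extend j ^^ c) S) = \<beta> k h (Suc j) (r - c * j) ((extend j ^^ c) S')"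
    if "r \<noteq> 0" "\<not> (r < j \<or> j = 0)" "c \<in> {..r div j}" for c
    using 1(1)[OF that(1,2)] that(3) rel by blast
  moreover have "k \<in> S \<longleftrightarrow> k \<in> S'" using 1(2) by (simp add: relevant_def)
  ultimately show ?case unfolding \<beta>.simps[of k h j r] by (auto intro!: sum.cong)
qed

lemma \<beta>_hit:
  assumes "k \<in> S" "k \<in> S'" shows "\<beta> k h j r S = \<beta> k h j r S'"
  using assms
proof (induction k h j r S arbitrary: S' rule: \<beta>.induct)
  case (1 k h j r S)
  have ext: "k \<in> T \<Longrightarrow> k \<in> (extend j ^^ c) T" for c T
    by (induction c) (auto simp: extend_def)
  have "\<beta> k h (Suc j) (r - c * j) ((extend j ^^ c) S) = \<beta> k h (Suc j) (r - c * j) ((extend j ^^ c) S')"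
    if "r \<noteq> 0" "\<not> (r < j \<or> j = 0)" "c \<in> {..r div j}" for c
    using 1(1)[OF that(1,2)] that(3) ext 1(2,3) by blast
  thus ?case using 1(2,3) unfolding \<beta>.simps[of k h j r] by (auto intro!: sum.cong)
qed

lemma \<beta>_nonneg: "0 \<le> \<beta> k h j r S"
proof (induction k h j r S rule: \<beta>.induct)
  case (1 k h j r S) thus ?case unfolding \<beta>.simps[of k h j r] by (auto intro!: sum_nonneg)
qed

section \<open>Integers, polynomials and tries as data\<close>

text \<open>
  Numbers in base 4, least significant digit first. A unary constructor for each digit lets addition
  and division proceed by one or two rewrite steps per digit.
\<close>

datatype quad = E | D0 quad | D1 quad | D2 quad | D3 quad

primrec qval :: "quad \<Rightarrow> int" where
  "qval E = 0" | "qval (D0 x) = 4 * qval x" | "qval (D1 x) = 4 * qval x + 1"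
| "qval (D2 x) = 4 * qval x + 2" | "qval (D3 x) = 4 * qval x + 3"

lemma qval_shift: "qval ((D0 ^^ n) x) = 4 ^ n * qval x"
  by (induction n) auto

lemma qval_nonneg: "0 \<le> qval x"
  by (induction x) auto

fun inc where "inc E = D1 E" | "inc (D0 x) = D1 x" | "inc (D1 x) = D2 x" | "inc (D2 x) = D3 x" | "inc (D3 x) = D0 (inc x)"
fun add and adc where
 "add E y = y" | "add (D0 x) E = D0 x" | "add (D1 x) E = D1 x" | "add (D2 x) E = D2 x" | "add (D3 x) E = D3 x"
| "add (D0 x) (D0 y) = D0 (add x y)" | "add (D0 x) (D1 y) = D1 (add x y)" | "add (D0 x) (D2 y) = D2 (add x y)" | "add (D0 x) (D3 y) = D3 (add x y)"
| "add (D1 x) (D0 y) = D1 (add x y)" | "add (D1 x) (D1 y) = D2 (add x y)" | "add (D1 x) (D2 y) = D3 (add x y)" | "add (D1 x) (D3 y) = D0 (adc x y)"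
| "add (D2 x) (D0 y) = D2 (add x y)" | "add (D2 x) (D1 y) = D3 (add x y)" | "add (D2 x) (D2 y) = D0 (adc x y)" | "add (D2 x) (D3 y) = D1 (adc x y)"
| "add (D3 x) (D0 y) = D3 (add x y)" | "add (D3 x) (D1 y) = D0 (adc x y)" | "add (D3 x) (D2 y) = D1 (adc x y)" | "add (D3 x) (D3 y) = D2 (adc x y)"
| "adc E y = inc y" | "adc (D0 x) E = D1 x" | "adc (D1 x) E = D2 x" | "adc (D2 x) E = D3 x" | "adc (D3 x) E = D0 (inc x)"
| "adc (D0 x) (D0 y) = D1 (add x y)" | "adc (D0 x) (D1 y) = D2 (add x y)" | "adc (D0 x) (D2 y) = D3 (add x y)" | "adc (D0 x) (D3 y) = D0 (adc x y)"
| "adc (D1 x) (D0 y) = D2 (add x y)" | "adc (D1 x) (D1 y) = D3 (add x y)" | "adc (D1 x) (D2 y) = D0 (adc x y)" | "adc (D1 x) (D3 y) = D1 (adc x y)"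
| "adc (D2 x) (D0 y) = D3 (add x y)" | "adc (D2 x) (D1 y) = D0 (adc x y)" | "adc (D2 x) (D2 y) = D1 (adc x y)" | "adc (D2 x) (D3 y) = D2 (adc x y)"
| "adc (D3 x) (D0 y) = D0 (adc x y)" | "adc (D3 x) (D1 y) = D1 (adc x y)" | "adc (D3 x) (D2 y) = D2 (adc x y)" | "adc (D3 x) (D3 y) = D3 (adc x y)"

lemma qval_inc: "qval (inc x) = qval x + 1"
  by (induction x) auto

lemma qval_add: "qval (add x y) = qval x + qval y" and qval_adc: "qval (adc x y) = qval x + qval y + 1"
  by (induction x y and x y rule: add_adc.induct) (auto simp: qval_inc)

text \<open>
  Prepending the digit 0 without creating leading zeros: zero has to be represented by \<open>E\<close> alone, so
  that states of negligible weight disappear.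
\<close>

fun q0 where "q0 E = E" | "q0 (D0 x) = D0 (D0 x)" | "q0 (D1 x) = D0 (D1 x)" | "q0 (D2 x) = D0 (D2 x)" | "q0 (D3 x) = D0 (D3 x)"

lemma qval_q0 [simp]: "qval (q0 x) = 4 * qval x"
  by (cases x) auto

text \<open>
  Division of base 4 numbers is long division: an automaton reads the digits from the top, and its
  state \<open>Q d r x\<close> consists of the divisor, the current remainder and the quotient so far. For fixed
  \<open>d\<close> the transitions form a finite table, which is generated in \<open>step_table\<close>.
\<close>

datatype quot = Q int int quad

definition qnext :: "int \<Rightarrow> int \<Rightarrow> quad \<Rightarrow> quot" where
  "qnext d n x = (if n < d then Q d n (q0 x) else if n < 2 * d then Q d (n - d) (D1 x)
    else if n < 3 * d then Q d (n - 2 * d) (D2 x) else Q d (n - 3 * d) (D3 x))"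

primrec step0 where "step0 (Q d r x) = qnext d (4 * r) x"
primrec step1 where "step1 (Q d r x) = qnext d (4 * r + 1) x"
primrec step2 where "step2 (Q d r x) = qnext d (4 * r + 2) x"
primrec step3 where "step3 (Q d r x) = qnext d (4 * r + 3) x"

primrec qdiv :: "int \<Rightarrow> quad \<Rightarrow> quot" where
  "qdiv d E = Q d 0 E" | "qdiv d (D0 x) = step0 (qdiv d x)" | "qdiv d (D1 x) = step1 (qdiv d x)"
| "qdiv d (D2 x) = step2 (qdiv d x)" | "qdiv d (D3 x) = step3 (qdiv d x)"

primrec quot_inv :: "int \<Rightarrow> int \<Rightarrow> quot \<Rightarrow> bool" where
  "quot_inv d v (Q d' r x) \<longleftrightarrow> d' = d \<and> 0 \<le> r \<and> r < d \<and> v = d * qval x + r"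

lemma quot_inv_qnext:
  assumes "0 \<le> n" "n < 4 * d" shows "quot_inv d (4 * d * qval x + n) (qnext d n x)"
  using assms by (simp add: qnext_def algebra_simps)

lemma quot_inv_step:
  assumes "quot_inv d v q"
  shows "quot_inv d (4 * v) (step0 q)" "quot_inv d (4 * v + 1) (step1 q)"
    "quot_inv d (4 * v + 2) (step2 q)" "quot_inv d (4 * v + 3) (step3 q)"
proof -
  obtain r x where q: "q = Q d r x" "0 \<le> r" "r < d" "v = d * qval x + r"
    using assms by (cases q) auto
  show "quot_inv d (4 * v) (step0 q)" "quot_inv d (4 * v + 1) (step1 q)"
    "quot_inv d (4 * v + 2) (step2 q)" "quot_inv d (4 * v + 3) (step3 q)"
    using quot_inv_qnext[of "4 * r" d x] quot_inv_qnext[of "4 * r + 1" d x]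
      quot_inv_qnext[of "4 * r + 2" d x] quot_inv_qnext[of "4 * r + 3" d x] q
    by (simp_all add: algebra_simps)
qed

lemma quot_inv_qdiv: "d > 0 \<Longrightarrow> quot_inv d (qval x) (qdiv d x)"
  by (induction x) (simp_all add: quot_inv_step del: quot_inv.simps, simp)

text \<open>
  A polynomial lists the weights of one set of sums by the number \<open>i\<close> of points that are still
  free, starting with \<open>i = 0\<close>. Using up \<open>j\<close> points then means dropping the first \<open>j\<close> entries, and
  weights that would use more points than there are vanish without any test. A zero coefficient has
  its own constructor because most coefficients are zero.
\<close>

datatype pol = PE | PZ pol | PV quad pol

text \<open>
  The total of the weights when a unit of weight with \<open>i\<close> free points is worth \<open>v i\<close>.
\<close>

fun pval :: "(nat \<Rightarrow> real) \<Rightarrow> nat \<Rightarrow> pol \<Rightarrow> real" where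
  "pval v i PE = 0" | "pval v i (PZ p) = pval v (Suc i) p"
| "pval v i (PV x p) = of_int (qval x) * v i + pval v (Suc i) p"

lemma pval_nonneg: "(\<And>i. 0 \<le> v i) \<Longrightarrow> 0 \<le> pval v i p"
  by (induction p arbitrary: i) (auto simp: qval_nonneg)

lemma pval_cong: "(\<And>t. v (i + t) = w (j + t)) \<Longrightarrow> pval v i p = pval w j p"
proof (induction p arbitrary: i j)
  case (PZ p) show ?case using PZ(1)[of "Suc i" "Suc j"] PZ(2)[of "Suc _"] by simp
next
  case (PV x p) show ?case using PV(1)[of "Suc i" "Suc j"] PV(2)[of "Suc _"] PV(2)[of 0] by simp
qed simp

fun padd where "padd PE y = y" | "padd (PZ p) PE = PZ p" | "padd (PV v p) PE = PV v p"
 | "padd (PZ p) (PZ q) = PZ (padd p q)" | "padd (PZ p) (PV v q) = PV v (padd p q)" | "padd (PV v p) (PZ q) = PV v (padd p q)"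
 | "padd (PV v p) (PV u q) = PV (add v u) (padd p q)"

lemma pval_padd: "pval v i (padd p q) = pval v i p + pval v i q"
  by (induction p q arbitrary: i rule: padd.induct) (auto simp: qval_add algebra_simps)

fun pzero where "pzero PE = PE" | "pzero (PZ p) = PZ (PZ p)" | "pzero (PV v p) = PZ (PV v p)"

lemma pval_pzero [simp]: "pval v i (pzero p) = pval v (Suc i) p"
  by (cases p) auto

fun pquot where "pquot (Q d r E) p = pzero p" | "pquot (Q d r (D0 x)) p = PV (D0 x) p" | "pquot (Q d r (D1 x)) p = PV (D1 x) p"
 | "pquot (Q d r (D2 x)) p = PV (D2 x) p" | "pquot (Q d r (D3 x)) p = PV (D3 x) p"

lemma pval_pquot [simp]: "pval v i (pquot (Q d r x) p) = of_int (qval x) * v i + pval v (Suc i) p"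
  by (cases x) auto

fun pdiv where "pdiv d PE = PE" | "pdiv d (PZ p) = pzero (pdiv d p)" | "pdiv d (PV x p) = pquot (qdiv d x) (pdiv d p)"

lemma pval_pdiv:
  assumes "\<And>i. 0 \<le> v i" "d > 0"
  shows "of_int d * pval v i (pdiv d p) \<le> pval v i p"
proof (induction p arbitrary: i)
  case (PV x p)
  have "of_int d * pval v i (pquot (qdiv d x) q) \<le> of_int (qval x) * v i + of_int d * pval v (Suc i) q" for q
  proof (cases "qdiv d x")
    case (Q d' r y)
    hence "d * qval y \<le> qval x" using quot_inv_qdiv[OF assms(2), of x] by simp
    hence "of_int d * of_int (qval y) \<le> (of_int (qval x) :: real)" by (metis of_int_le_iff of_int_mult)
    hence "of_int d * of_int (qval y) * v i \<le> of_int (qval x) * v i" using assms(1) by (intro mult_right_mono)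
    thus ?thesis using Q by (simp add: algebra_simps)
  qed
  from this[of "pdiv d p"] show ?case using PV[of "Suc i"] by simp
qed auto

text \<open>
  Moves \<open>length z\<close> points into a cycle and divides by \<open>d\<close>. Only the length of \<open>z\<close> counts; a list is
  used since it can be traversed by pattern matching.
\<close>

fun pshift :: "int \<Rightarrow> bool list \<Rightarrow> pol \<Rightarrow> pol" where
  "pshift d [] p = pdiv d p" | "pshift d (b # z) PE = PE"
| "pshift d (b # z) (PZ p) = pshift d z p" | "pshift d (b # z) (PV x p) = pshift d z p"

lemma pval_pshift:
  assumes nonneg: "\<And>i. 0 \<le> v i" "\<And>i. 0 \<le> w i" and "d > 0" "\<And>t. w (i + length z + t) = v t"
  shows "of_int d * pval v 0 (pshift d z p) \<le> pval w i p"
  using assms(3,4)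
proof (induction d z p arbitrary: i rule: pshift.induct)
  case (1 d p)
  have "pval v 0 p = pval w i p" using 1 by (intro pval_cong) simp
  thus ?case using pval_pdiv[of v d 0 p] 1(1) nonneg by simp
next
  case (4 d b z x p)
  have "of_int d * pval v 0 (pshift d z p) \<le> pval w (Suc i) p" using 4(1)[OF 4(2), of "Suc i"] 4(3) by simp
  moreover have "0 \<le> of_int (qval x) * w i" using nonneg by (simp add: qval_nonneg)
  ultimately show ?case by simp
qed (auto simp: qval_nonneg nonneg pval_nonneg)

text \<open>
  A state table is a binary trie over the characteristic bits of \<open>S\<close>, lowest sum first; a node \<open>TB p q\<close>
  at the bottom carries the polynomials for the sets without and with the last sum. With this
  orientation, forgetting the largest sum, which becomes irrelevant from one cycle length to the
  next, merges neighbouring leaves.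
\<close>

datatype trie = TE | TN trie trie | TB pol pol

text \<open>
  \<open>X\<close> collects the sums on the path from the root, and \<open>i\<close> is the depth.
\<close>

fun tval :: "(nat set \<Rightarrow> nat \<Rightarrow> real) \<Rightarrow> nat \<Rightarrow> nat set \<Rightarrow> trie \<Rightarrow> real" where
  "tval f i X TE = 0"
| "tval f i X (TN l r) = tval f (Suc i) X l + tval f (Suc i) (insert i X) r"
| "tval f i X (TB p q) = pval (f X) 0 p + pval (f (insert i X)) 0 q"

fun twf :: "nat \<Rightarrow> nat \<Rightarrow> trie \<Rightarrow> bool" where
  "twf m i TE \<longleftrightarrow> True"
| "twf m i (TN l r) \<longleftrightarrow> i < m \<and> twf m (Suc i) l \<and> twf m (Suc i) r"
| "twf m i (TB p q) \<longleftrightarrow> i = m"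

lemma tval_nonneg: "(\<And>S r. 0 \<le> f S r) \<Longrightarrow> 0 \<le> tval f i X T"
  by (induction T arbitrary: i X) (auto intro!: add_nonneg_nonneg pval_nonneg)

fun tnode where "tnode TE TE = TE" | "tnode TE (TN a b) = TN TE (TN a b)" | "tnode TE (TB a b) = TN TE (TB a b)"
 | "tnode (TN a b) y = TN (TN a b) y" | "tnode (TB a b) y = TN (TB a b) y"

fun tright where "tright TE = TE" | "tright (TN a b) = TN TE (TN a b)" | "tright (TB a b) = TN TE (TB a b)"

fun tleaf0 where "tleaf0 PE = TE" | "tleaf0 (PZ p) = TB (PZ p) PE" | "tleaf0 (PV x p) = TB (PV x p) PE"

fun tleaf1 where "tleaf1 PE = TE" | "tleaf1 (PZ p) = TB PE (PZ p)" | "tleaf1 (PV x p) = TB PE (PV x p)"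

fun tunion where "tunion TE y = y" | "tunion (TN a b) TE = TN a b" | "tunion (TB a b) TE = TB a b"
 | "tunion (TN a b) (TN c d) = TN (tunion a c) (tunion b d)"
 | "tunion (TB a b) (TB c d) = TB (padd a c) (padd b d)" | "tunion (TN a b) (TB c d) = TE" | "tunion (TB a b) (TN c d) = TE"

fun ttrunc where "ttrunc TE = TE" | "ttrunc (TB a b) = TE" | "ttrunc (TN TE TE) = TE"
 | "ttrunc (TN (TB a b) (TB c d)) = TB (padd a b) (padd c d)"
 | "ttrunc (TN (TB a b) TE) = TB (padd a b) PE" | "ttrunc (TN TE (TB c d)) = TB PE (padd c d)"
 | "ttrunc (TN (TN a b) y) = TN (ttrunc (TN a b)) (ttrunc y)" | "ttrunc (TN TE (TN a b)) = TN TE (ttrunc (TN a b))"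
 | "ttrunc (TN (TB c d) (TN a b)) = TE"

text \<open>
  At cycle length \<open>j\<close> the last bit stands for the sum \<open>k - j\<close>. The states that contain it turn into
  hits with the next \<open>j\<close>-cycle and leave the trie.
\<close>

fun thits where "thits TE = PE" | "thits (TN l r) = padd (thits l) (thits r)" | "thits (TB p q) = q"

lemma tval_tnode [simp]: "tval f i X (tnode l r) = tval f (Suc i) X l + tval f (Suc i) (insert i X) r"
  by (cases l; cases r) simp_all

lemma tval_tright [simp]: "tval f i X (tright r) = tval f (Suc i) (insert i X) r"
  by (cases r) simp_all

lemma tval_tleaf0 [simp]: "tval f i X (tleaf0 p) = pval (f X) 0 p"
  by (cases p) simp_all

lemma tval_tleaf1 [simp]: "tval f i X (tleaf1 p) = pval (f (insert i X)) 0 p"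
  by (cases p) simp_all

lemma twf_tnode [simp]: "i < m \<Longrightarrow> twf m (Suc i) l \<Longrightarrow> twf m (Suc i) r \<Longrightarrow> twf m i (tnode l r)"
  by (cases l; cases r) simp_all

lemma twf_tright [simp]: "i < m \<Longrightarrow> twf m (Suc i) r \<Longrightarrow> twf m i (tright r)"
  by (cases r) simp_all

lemma twf_tleaf [simp]: "twf m m (tleaf0 p)" "twf m m (tleaf1 p)"
  by (cases p; simp)+

lemma twf_tunion [simp]: "twf m i a \<Longrightarrow> twf m i b \<Longrightarrow> twf m i (tunion a b)"
  by (induction a b arbitrary: i rule: tunion.induct) auto

lemma tval_tunion:
  assumes "\<And>S r. 0 \<le> f S r"
  shows "tval f i X (tunion a b) \<le> tval f i X a + tval f i X b"
proof (induction a b arbitrary: i X rule: tunion.induct)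
  case (4 a b c d)
  show ?case using 4(1)[of "Suc i" X] 4(2)[of "Suc i" "insert i X"] by simp
qed (auto simp: pval_padd intro!: add_nonneg_nonneg tval_nonneg pval_nonneg assms)

lemma twf_ttrunc: "twf (Suc m) i T \<Longrightarrow> twf m i (ttrunc T)"
  by (induction T arbitrary: i rule: ttrunc.induct) auto

lemma tval_ttrunc:
  assumes "\<And>S r. 0 \<le> f S r" "\<And>S. f (insert m S) = f S" "twf m i T"
  shows "tval f i X (ttrunc T) \<le> tval f i X T"
  using assms(3)
proof (induction T arbitrary: i X rule: ttrunc.induct)
  case (7 a b y)
  show ?case using 7(1)[of "Suc i" X] 7(2)[of "Suc i" "insert i X"] 7(3) by simp
next
  case (8 a b)
  show ?case using 8(1)[of "Suc i" "insert i X"] 8(2) by simp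
qed (auto simp: pval_padd assms(2) intro!: add_nonneg_nonneg tval_nonneg pval_nonneg assms(1))

fun revonto where "revonto [] y = y" | "revonto (b # x) y = revonto x (b # y)"

lemma revonto: "revonto x y = rev x @ y"
  by (induction x y rule: revonto.induct) auto

text \<open>
  Adds one \<open>j\<close>-cycle to all states that are not thereby hits: the set \<open>S\<close> becomes \<open>extend j S\<close>, which
  means that bit \<open>i\<close> is set if bit \<open>i\<close> or bit \<open>i - j\<close> was. The pending bits \<open>i - j, i - j + 1, ...\<close> are
  queued in \<open>z\<close>, those just read are stacked in \<open>w\<close>, and when \<open>z\<close> is used up the reversed stack takes
  its place. As the traversal follows the order of the bits, the new trie has the same shape, except
  that two branches are united where a pending bit is set.
\<close>

function (sequential) tshift :: "int \<Rightarrow> bool list \<Rightarrow> bool list \<Rightarrow> bool list \<Rightarrow> trie \<Rightarrow> trie" where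
  "tshift d u z w TE = TE"
| "tshift d u [] [] (TN l r) = TE"
| "tshift d u [] [] (TB p q) = TE"
| "tshift d u [] (b # w) (TN l r) = tshift d u (revonto w [b]) [] (TN l r)"
| "tshift d u [] (b # w) (TB p q) = tshift d u (revonto w [b]) [] (TB p q)"
| "tshift d u (False # z) w (TN l r) = tnode (tshift d u z (False # w) l) (tshift d u z (True # w) r)"
| "tshift d u (True # z) w (TN l r) = tright (tunion (tshift d u z (False # w) l) (tshift d u z (True # w) r))"
| "tshift d u (False # z) w (TB p q) = tleaf0 (pshift d u p)"
| "tshift d u (True # z) w (TB p q) = tleaf1 (pshift d u p)"
  by pat_completeness auto
termination
  by (relation "measure (\<lambda>(d,u,z,w,T). 2 * size T + (if z = [] then 1 else 0))") (auto simp: revonto)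

lemma twf_tshift: "twf m i T \<Longrightarrow> twf m i (tshift d u z w T)"
  by (induction d u z w T arbitrary: i rule: tshift.induct) auto

section \<open>Adding one cycle to every state\<close>

text \<open>
  The invariant of the queue and the stack of \<open>tshift\<close> at depth \<open>i\<close> below the path \<open>X\<close>.
\<close>

definition pending :: "nat \<Rightarrow> bool list \<Rightarrow> bool list \<Rightarrow> nat \<Rightarrow> nat set \<Rightarrow> bool" where
  "pending j z w i X \<longleftrightarrow> length z + length w = j \<and> X \<subseteq> {..<i}
     \<and> (\<forall>t<length z. z ! t \<longleftrightarrow> j \<le> i + t \<and> i + t - j \<in> X)
     \<and> (\<forall>t<length w. w ! t \<longleftrightarrow> t < i \<and> i - Suc t \<in> X)"

lemma pending_revonto:
  assumes "pending j [] w i X" shows "pending j (revonto w []) [] i X"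
  unfolding pending_def
proof (intro conjI allI impI)
  fix t assume t: "t < length (revonto w [])"
  have l: "length w = j" using assms by (simp add: pending_def)
  have "revonto w [] ! t = w ! (j - Suc t)" using t l by (simp add: revonto rev_nth)
  also have "\<dots> \<longleftrightarrow> j - Suc t < i \<and> i - Suc (j - Suc t) \<in> X"
    using assms t l by (simp add: pending_def revonto)
  also have "i - Suc (j - Suc t) = i + t - j" using t l by (simp add: revonto)
  also have "j - Suc t < i \<longleftrightarrow> j \<le> i + t" using t l by (auto simp: revonto)
  finally show "revonto w [] ! t \<longleftrightarrow> j \<le> i + t \<and> i + t - j \<in> X" .
qed (use assms in \<open>auto simp: pending_def revonto\<close>)

lemma pending_step:
  assumes "pending j (b # z) w i X" "X' = X \<and> \<not> c \<or> X' = insert i X \<and> c"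
  shows "pending j z (c # w) (Suc i) X'"
  unfolding pending_def
proof (intro conjI allI impI)
  have i: "i \<notin> X" using assms(1) by (auto simp: pending_def)
  show "length z + length (c # w) = j" using assms(1) by (simp add: pending_def)
  show "X' \<subseteq> {..<Suc i}" using assms by (auto simp: pending_def)
  fix t
  { assume t: "t < length z"
    hence "z ! t \<longleftrightarrow> j \<le> Suc i + t \<and> Suc i + t - j \<in> X"
      using assms(1) unfolding pending_def by (metis Suc_less_eq add_Suc_shift length_Cons nth_Cons_Suc)
    moreover have "Suc (length z + length w) = j" using assms(1) by (simp add: pending_def)
    hence "j \<le> Suc i + t \<Longrightarrow> Suc i + t - j \<noteq> i" using t by linarith
    ultimately show "z ! t \<longleftrightarrow> j \<le> Suc i + t \<and> Suc i + t - j \<in> X'" using assms(2) by auto }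
  { assume t: "t < length (c # w)"
    show "(c # w) ! t \<longleftrightarrow> t < Suc i \<and> Suc i - Suc t \<in> X'"
    proof (cases t)
      case 0 thus ?thesis using assms(2) i by auto
    next
      case (Suc t')
      hence "(c # w) ! t \<longleftrightarrow> t' < i \<and> i - Suc t' \<in> X" using t assms(1) by (simp add: pending_def)
      thus ?thesis using assms(2) Suc by auto
    qed }
qed

lemma pending_head:
  assumes "pending j (b # z) w i X"
  shows "X \<subseteq> {..<i}" "b \<longleftrightarrow> j \<le> i \<and> i - j \<in> X"
proof -
  show "X \<subseteq> {..<i}" using assms by (simp add: pending_def)
  have "(b # z) ! 0 \<longleftrightarrow> j \<le> i + 0 \<and> i + 0 - j \<in> X"
    using assms unfolding pending_def by blast
  thus "b \<longleftrightarrow> j \<le> i \<and> i - j \<in> X" by simp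
qed

lemma extend_step:
  assumes "X \<subseteq> {..<i}" "X' = X \<or> X' = insert i X" "j > 0"
  shows "extend j X' \<inter> {..<Suc i}
      = (if i \<in> X' \<or> (j \<le> i \<and> i - j \<in> X) then insert i (extend j X \<inter> {..<i}) else extend j X \<inter> {..<i})"
proof -
  have e: "s \<in> extend j T \<longleftrightarrow> s \<in> T \<or> (j \<le> s \<and> s - j \<in> T)" for s T
    by (force simp: extend_def)
  have "s \<in> extend j X' \<longleftrightarrow> s \<in> extend j X" if "s < i" for s
    using assms that unfolding e by auto
  moreover have "i \<in> extend j X' \<longleftrightarrow> i \<in> X' \<or> (j \<le> i \<and> i - j \<in> X)"
    using assms unfolding e by auto
  ultimately show ?thesis by (auto simp: less_Suc_eq)
qed

text \<open>
  The values \<open>f\<close> and \<open>g\<close> abstract from \<open>\<beta>\<close>: \<open>f\<close> before and \<open>g\<close> after a \<open>j\<close>-cycle has been removed. All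
  that is used is how they are related, that \<open>g\<close> depends on the relevant sums only, and that the
  sum \<open>m = k - j\<close> together with a \<open>j\<close>-cycle is as good as the sum \<open>k\<close>.
\<close>

lemma tval_tshift:
  fixes f g :: "nat set \<Rightarrow> nat \<Rightarrow> real"
  assumes nonneg: "\<And>S r. 0 \<le> f S r" "\<And>S r. 0 \<le> g S r"
    and j: "j > 0" "m + j = k"
    and rec: "\<And>S t. f S (j + t) = g (extend j S) t"
    and rel: "\<And>S S'. relevant k j S S' \<Longrightarrow> g S = g S'"
    and hit: "\<And>S. m \<in> S \<Longrightarrow> f S = f {k}"
  shows "d > 0 \<Longrightarrow> length u = j \<Longrightarrow> twf m i T \<Longrightarrow> pending j z w i X \<Longrightarrow>
    of_int d * tval g i (extend j X \<inter> {..<i}) (tshift d u z w T) + pval (f {k}) 0 (thits T) \<le> tval f i X T"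
proof (induction d u z w T arbitrary: i X rule: tshift.induct)
  case (1 d u z w) thus ?case by simp
next
  case (2 d u l r) thus ?case using j by (simp add: pending_def)
next
  case (3 d u p q) thus ?case using j by (simp add: pending_def)
next
  case (4 d u b w l r)
  have "pending j (revonto w [b]) [] i X" using pending_revonto[OF 4(5)] by simp
  thus ?case using 4(1)[OF 4(2,3,4)] by simp
next
  case (5 d u b w p q)
  have "pending j (revonto w [b]) [] i X" using pending_revonto[OF 5(5)] by simp
  thus ?case using 5(1)[OF 5(2,3,4)] by simp
next
  case (6 d u z w l r)
  have X: "i \<notin> X" "X \<subseteq> {..<i}" "\<not> (j \<le> i \<and> i - j \<in> X)"
    using pending_head[OF 6(6)] by auto
  have "twf m (Suc i) l" "twf m (Suc i) r" using 6(5) by auto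
  note IH = 6(1)[OF 6(3,4) this(1) pending_step[OF 6(6), of X False]]
    6(2)[OF 6(3,4) this(2) pending_step[OF 6(6), of "insert i X" True]]
  have "extend j X \<inter> {..<Suc i} = extend j X \<inter> {..<i}"
    "extend j (insert i X) \<inter> {..<Suc i} = insert i (extend j X \<inter> {..<i})"
    using extend_step[OF X(2) _ j(1), of X] extend_step[OF X(2) _ j(1), of "insert i X"] X by auto
  thus ?case using IH by (simp add: pval_padd algebra_simps)
next
  case (7 d u z w l r)
  have X: "i \<notin> X" "X \<subseteq> {..<i}" "j \<le> i \<and> i - j \<in> X"
    using pending_head[OF 7(6)] by auto
  have "twf m (Suc i) l" "twf m (Suc i) r" using 7(5) by auto
  note IH = 7(1)[OF 7(3,4) this(1) pending_step[OF 7(6), of X False]]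
    7(2)[OF 7(3,4) this(2) pending_step[OF 7(6), of "insert i X" True]]
  have *: "extend j X \<inter> {..<Suc i} = insert i (extend j X \<inter> {..<i})"
    "extend j (insert i X) \<inter> {..<Suc i} = insert i (extend j X \<inter> {..<i})"
    using extend_step[OF X(2) _ j(1), of X] extend_step[OF X(2) _ j(1), of "insert i X"] X by auto
  let ?l = "tshift d u z (False # w) l" and ?r = "tshift d u z (True # w) r"
  have "of_int d * tval g (Suc i) (insert i (extend j X \<inter> {..<i})) (tunion ?l ?r)
      \<le> of_int d * (tval g (Suc i) (insert i (extend j X \<inter> {..<i})) ?l + tval g (Suc i) (insert i (extend j X \<inter> {..<i})) ?r)"
    using 7(3) by (intro mult_left_mono tval_tunion nonneg) auto
  thus ?case using IH unfolding * by (simp add: pval_padd algebra_simps)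
next
  case (8 d u z w p q)
  have X: "X \<subseteq> {..<m}" "\<not> (j \<le> m \<and> m - j \<in> X)" and i: "i = m"
    using 8(3) pending_head[OF 8(4)] by simp_all
  have *: "extend j X \<inter> {..<Suc m} = extend j X \<inter> {..<m}"
    using extend_step[OF X(1) _ j(1), of X] X by auto
  have "relevant k j (extend j X \<inter> {..<m}) (extend j X)"
    unfolding relevant_def
  proof (intro allI impI)
    fix s assume s: "s + j \<le> k \<or> s = k"
    show "s \<in> extend j X \<inter> {..<m} \<longleftrightarrow> s \<in> extend j X"
    proof (cases "s = k")
      case True
      have "k \<notin> extend j X" using X(1) j by (auto simp: extend_def)
      thus ?thesis using True j by simp
    next
      case False
      hence "s \<in> {..<Suc m}" using s j by simp
      hence "s \<in> extend j X \<longleftrightarrow> s \<in> extend j X \<inter> {..<Suc m}" by blast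
      thus ?thesis unfolding * by blast
    qed
  qed
  from rel[OF this] have "of_int d * pval (g (extend j X \<inter> {..<m})) 0 (pshift d u p) \<le> pval (f X) 0 p"
    using 8(1,2) rec[of X] by (simp only:) (intro pval_pshift nonneg; simp)
  thus ?case using hit[of "insert m X"] i by simp
next
  case (9 d u z w p q)
  have X: "X \<subseteq> {..<m}" "j \<le> m \<and> m - j \<in> X" and i: "i = m"
    using 9(3) pending_head[OF 9(4)] by simp_all
  have *: "extend j X \<inter> {..<Suc m} = insert m (extend j X \<inter> {..<m})"
    using extend_step[OF X(1) _ j(1), of X] X by auto
  have "relevant k j (insert m (extend j X \<inter> {..<m})) (extend j X)"
    unfolding relevant_def
  proof (intro allI impI)
    fix s assume s: "s + j \<le> k \<or> s = k"
    show "s \<in> insert m (extend j X \<inter> {..<m}) \<longleftrightarrow> s \<in> extend j X"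
    proof (cases "s = k")
      case True
      have "k \<notin> extend j X" using X(1) j by (auto simp: extend_def)
      thus ?thesis using True j by simp
    next
      case False
      hence "s \<in> {..<Suc m}" using s j by simp
      hence "s \<in> extend j X \<longleftrightarrow> s \<in> extend j X \<inter> {..<Suc m}" by blast
      thus ?thesis unfolding * by blast
    qed
  qed
  from rel[OF this] have "of_int d * pval (g (insert m (extend j X \<inter> {..<m}))) 0 (pshift d u p) \<le> pval (f X) 0 p"
    using 9(1,2) rec[of X] by (simp only:) (intro pval_pshift nonneg; simp)
  thus ?case using hit[of "insert m X"] i by simp
qed

section \<open>The dynamic program\<close>

text \<open>
  The worth of a state that still has to receive \<open>s\<close> cycles of length \<open>j\<close> and then only longer ones,
  not yet divided by \<open>j^s * s!\<close>. The recurrence \<open>\<alpha>_Suc\<close> divides by \<open>s * j\<close> when the first of \<open>s\<close> cycles is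
  removed, whereas the program, which does not know how many cycles will follow, divides by \<open>j\<close> for
  the first cycle, by \<open>2j\<close> for the second, and so on. Leaving out the divisors reconciles the two.
  The offset \<open>e\<close> allows for several \<open>n\<close> in one run: with
  \<open>N\<close> points in the program, a state with \<open>i\<close> free points has \<open>i - e\<close> free points for \<open>n = N - e\<close>.
\<close>

definition peeled :: "nat \<Rightarrow> bool \<Rightarrow> nat \<Rightarrow> nat \<Rightarrow> nat \<Rightarrow> nat set \<Rightarrow> nat \<Rightarrow> real" where
  "peeled k h e j s S i = (if e + s * j \<le> i then \<beta> k h (Suc j) (i - e - s * j) ((extend j ^^ s) S) else 0)"

definition weight :: "nat \<Rightarrow> bool \<Rightarrow> nat \<Rightarrow> nat \<Rightarrow> nat set \<Rightarrow> nat \<Rightarrow> real" where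
  "weight k h e j S i = (if e \<le> i then \<beta> k h j (i - e) S else 0)"

lemma peeled_nonneg: "0 \<le> peeled k h e j s S i" by (simp add: peeled_def \<beta>_nonneg)
lemma weight_nonneg: "0 \<le> weight k h e j S i" by (simp add: weight_def \<beta>_nonneg)

lemma peeled_0: "peeled k h e j 0 = weight k h e (Suc j)"
  by (auto simp: peeled_def weight_def fun_eq_iff)

lemma peeled_Suc: "peeled k h e j (Suc s) S (j + t) = peeled k h e j s (extend j S) t"
  by (auto simp: peeled_def funpow_swap1 algebra_simps)

lemma peeled_relevant: "relevant k j S S' \<Longrightarrow> peeled k h e j s S = peeled k h e j s S'"
  using \<beta>_relevant[OF relevant_Suc[OF relevant_extend_funpow]] by (auto simp: peeled_def fun_eq_iff)

lemma weight_relevant: "relevant k j S S' \<Longrightarrow> weight k h e j S = weight k h e j S'"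
  using \<beta>_relevant by (auto simp: weight_def fun_eq_iff)

lemma peeled_hit:
  assumes "k \<in> S" "k \<in> S'" shows "peeled k h e j s S = peeled k h e j s S'"
proof -
  have "k \<in> T \<Longrightarrow> k \<in> (extend j ^^ s) T" for T
    by (induction s) (auto simp: extend_def)
  hence "\<beta> k h (Suc j) r ((extend j ^^ s) S) = \<beta> k h (Suc j) r ((extend j ^^ s) S')" for r
    using assms by (intro \<beta>_hit)
  thus ?thesis by (auto simp: peeled_def fun_eq_iff)
qed

lemma peeled_Suc_hit:
  assumes "k \<in> extend j S" "k \<in> extend j S'"
  shows "peeled k h e j (Suc s) S = peeled k h e j (Suc s) S'"
proof
  fix i
  have *: "peeled k h e j (Suc s) T i = (if j \<le> i then peeled k h e j s (extend j T) (i - j) else 0)" for T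
    using peeled_Suc[of k h e j s T "i - j"] by (auto simp: peeled_def)
  show "peeled k h e j (Suc s) S i = peeled k h e j (Suc s) S' i"
    unfolding * using peeled_hit[OF assms] by simp
qed

lemma sum_peeled_le_weight:
  assumes "j > 0"
  shows "(\<Sum>s\<le>n. peeled k h e j s S i / (real j ^ s * fact s)) \<le> weight k h e j S i"
proof (cases "e \<le> i")
  case True
  have \<alpha>: "peeled k h e j s S i / (real j ^ s * fact s) = \<alpha> k h j s (i - e) S" for s
    using True by (auto simp: peeled_def \<alpha>_def)
  have "(\<Sum>s\<le>n. \<alpha> k h j s (i - e) S) \<le> (\<Sum>s\<le>max n (i - e). \<alpha> k h j s (i - e) S)"
    by (rule sum_mono2) (auto simp: \<alpha>_def \<beta>_nonneg)
  also have "\<dots> = (\<Sum>s\<le>i - e. \<alpha> k h j s (i - e) S)"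
  proof (rule sum.mono_neutral_right)
    show "\<forall>s\<in>{..max n (i - e)} - {..i - e}. \<alpha> k h j s (i - e) S = 0"
    proof
      fix s assume "s \<in> {..max n (i - e)} - {..i - e}"
      hence "i - e < s" by simp
      also have "s \<le> s * j" using assms by simp
      finally have "\<not> s * j \<le> i - e" by simp
      thus "\<alpha> k h j s (i - e) S = 0" by (simp add: \<alpha>_def)
    qed
  qed auto
  also have "\<dots> = weight k h e j S i" using True by (simp add: weight_def \<beta>_eq_sum_\<alpha>[OF assms])
  finally show ?thesis unfolding \<alpha> .
next
  case False thus ?thesis by (simp add: peeled_def weight_def)
qed

lemma pval_mono: "(\<And>i. v i \<le> w i) \<Longrightarrow> pval v i p \<le> pval w i p"
  by (induction p arbitrary: i) (auto simp: qval_nonneg intro!: add_mono mult_left_mono)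

lemma pval_sum: "pval (\<lambda>i. \<Sum>s\<in>I. v s i / c s) i p = (\<Sum>s\<in>I. pval (v s) i p / c s)"
  by (induction p arbitrary: i) (auto simp: sum.distrib sum_distrib_left add_divide_distrib)

lemma tval_mono: "(\<And>S i. f S i \<le> g S i) \<Longrightarrow> tval f i X T \<le> tval g i X T"
  by (induction T arbitrary: i X) (auto intro!: add_mono pval_mono)

lemma tval_sum: "tval (\<lambda>S i. \<Sum>s\<in>I. v s S i / c s) i X T = (\<Sum>s\<in>I. tval (v s) i X T / c s)"
  by (induction T arbitrary: i X) (auto simp: sum.distrib add_divide_distrib pval_sum)

text \<open>
  The sum of \<open>f s / (d\<^sub>1 * ... * d\<^sub>s)\<close> over the nonempty prefixes of the list of divisors, in the form
  in which the loop over the number of \<open>j\<close>-cycles produces it.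
\<close>

primrec wsum :: "int list \<Rightarrow> (nat \<Rightarrow> real) \<Rightarrow> real" where
  "wsum [] f = 0"
| "wsum (d # ds) f = (f 1 + wsum ds (\<lambda>s. f (Suc s))) / of_int d"

lemma wsum_mono: "(\<And>s. f s \<le> g s) \<Longrightarrow> \<forall>d\<in>set ds. d > 0 \<Longrightarrow> wsum ds f \<le> wsum ds g"
  by (induction ds arbitrary: f g) (auto intro!: divide_right_mono add_mono)

lemma wsum_add: "wsum ds (\<lambda>s. f s + g s) = wsum ds f + wsum ds g"
  by (induction ds arbitrary: f g) (auto simp: add_divide_distrib)

lemma wsum_divide: "wsum ds (\<lambda>s. f s / c) = wsum ds f / c"
  by (induction ds arbitrary: f) (auto simp: add_divide_distrib mult_ac)

lemma wsum_cong: "(\<And>s. f (Suc s) = g (Suc s)) \<Longrightarrow> wsum ds f = wsum ds g"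
proof (induction ds arbitrary: f g)
  case (Cons d ds)
  show ?case using Cons.IH[of "\<lambda>s. f (Suc s)" "\<lambda>s. g (Suc s)"] Cons.prems Cons.prems[of 0] by simp
qed simp

definition multiples :: "nat \<Rightarrow> nat \<Rightarrow> int list" where
  "multiples M j = map (\<lambda>c. int c * int j) [1..<Suc (M div j)]"

lemma wsum_multiples_aux:
  assumes "j > 0"
  shows "wsum (map (\<lambda>c. int c * int j) [Suc c..<Suc (c + n)]) f = (\<Sum>s<n. f (Suc s) * fact c / (real j ^ Suc s * fact (c + Suc s)))"
proof (induction n arbitrary: c f)
  case (Suc n)
  have "[Suc c..<Suc (c + Suc n)] = Suc c # [Suc (Suc c)..<Suc (Suc c + n)]"
    by (subst upt_conv_Cons) auto
  hence "wsum (map (\<lambda>c. int c * int j) [Suc c..<Suc (c + Suc n)]) f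
      = (f 1 + (\<Sum>s<n. f (Suc (Suc s)) * fact (Suc c) / (real j ^ Suc s * fact (Suc c + Suc s)))) / (real (Suc c) * real j)"
    using Suc.IH[of "Suc c" "\<lambda>s. f (Suc s)"] by (simp del: upt_Suc of_nat_Suc fact_Suc)
  also have "\<dots> = f 1 / (real (Suc c) * real j) + (\<Sum>s<n. f (Suc (Suc s)) * fact (Suc c) / (real j ^ Suc s * fact (Suc c + Suc s)) / (real (Suc c) * real j))"
    by (simp add: add_divide_distrib sum_divide_distrib del: of_nat_Suc)
  also have "\<dots> = (\<Sum>s<Suc n. f (Suc s) * fact c / (real j ^ Suc s * fact (c + Suc s)))"
  proof -
    have "f (Suc (Suc s)) * fact (Suc c) / (real j ^ Suc s * fact (Suc c + Suc s)) / (real (Suc c) * real j)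
        = f (Suc (Suc s)) * fact c / (real j ^ Suc (Suc s) * fact (c + Suc (Suc s)))" for s
      by (simp add: fact_Suc[of c] mult_ac del: of_nat_Suc)
    moreover have "f 1 / (real (Suc c) * real j) = f (Suc 0) * fact c / (real j ^ Suc 0 * fact (c + Suc 0))"
      by (simp add: mult_ac)
    ultimately show ?thesis unfolding sum.lessThan_Suc_shift by (simp only:)
  qed
  finally show ?case .
qed simp

lemma wsum_multiples:
  assumes "j > 0"
  shows "f 0 + wsum (multiples M j) f = (\<Sum>s\<le>M div j. f s / (real j ^ s * fact s))"
proof -
  have "wsum (multiples M j) f = (\<Sum>s<M div j. f (Suc s) / (real j ^ Suc s * fact (Suc s)))"
    using wsum_multiples_aux[OF assms, of 0 "M div j" f] by (simp add: multiples_def del: upt_Suc)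
  thus ?thesis by (simp only: lessThan_Suc_atMost[symmetric] sum.lessThan_Suc_shift) simp
qed

lemma multiples_pos: "j > 0 \<Longrightarrow> \<forall>d\<in>set (multiples M j). d > 0"
  by (auto simp: multiples_def)

text \<open>
  The invariant of the dynamic program. The trie \<open>T\<close> contains the undecided states and the polynomial
  \<open>G\<close> the hits, whose set of sums may be replaced by \<open>{k}\<close>. For \<open>h = False\<close> the hits are worth nothing.
\<close>

definition mass :: "nat \<Rightarrow> (nat set \<Rightarrow> nat \<Rightarrow> real) \<Rightarrow> trie \<Rightarrow> pol \<Rightarrow> real" where
  "mass k f T G = tval f 0 {} T + pval (f {k}) 0 G"

lemma mass_tshift:
  assumes "j > 0" "m + j = k" "twf m 0 T" "d > 0"
  defines "u \<equiv> replicate j False"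
  shows "mass k (peeled k h e j s) (tshift d u u [] T) (pshift d u (padd G (thits T))) \<le> mass k (peeled k h e j (Suc s)) T G / of_int d"
proof -
  have pend: "pending j u [] 0 {}" by (simp add: pending_def u_def)
  have hit: "peeled k h e j (Suc s) S = peeled k h e j (Suc s) {k}" if "m \<in> S" for S
    using that assms(2) by (intro peeled_Suc_hit) (auto simp: extend_def)
  have "of_int d * tval (peeled k h e j s) 0 (extend j {} \<inter> {..<0}) (tshift d u u [] T) + pval (peeled k h e j (Suc s) {k}) 0 (thits T)
      \<le> tval (peeled k h e j (Suc s)) 0 {} T"
    by (rule tval_tshift[where f = "peeled k h e j (Suc s)" and g = "peeled k h e j s",
          OF peeled_nonneg peeled_nonneg assms(1,2) peeled_Suc peeled_relevant hit assms(4) _ assms(3) pend])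
      (auto simp: u_def)
  moreover have "of_int d * pval (peeled k h e j s {k}) 0 (pshift d u (padd G (thits T))) \<le> pval (peeled k h e j (Suc s) {k}) 0 (padd G (thits T))"
  proof (rule pval_pshift[OF peeled_nonneg peeled_nonneg assms(4)])
    fix t show "peeled k h e j (Suc s) {k} (0 + length u + t) = peeled k h e j s {k} t"
      using peeled_Suc[of k h e j s "{k}" t] peeled_hit[of k "extend j {k}" "{k}"] by (simp add: u_def extend_def)
  qed
  ultimately have "of_int d * mass k (peeled k h e j s) (tshift d u u [] T) (pshift d u (padd G (thits T))) \<le> mass k (peeled k h e j (Suc s)) T G"
    by (simp add: mass_def pval_padd algebra_simps)
  thus ?thesis using assms(4) by (simp add: le_divide_eq mult.commute)
qed

text \<open>
  Iterates over the number of \<open>j\<close>-cycles, with \<open>u\<close> of length \<open>j\<close>. The states with the current number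
  are \<open>t\<close> and \<open>G\<close>; \<open>acc\<close> and \<open>tot\<close> accumulate the states for the next cycle length. The detour
  through \<open>loop2\<close> makes rewriting evaluate the new states once, before they are duplicated.
\<close>

fun loop and loop2 where
  "loop u [] t acc G tot = (acc, tot)"
| "loop u (d # ds) t acc G tot = loop2 u ds (tshift d u u [] t) acc (pshift d u (padd G (thits t))) tot"
| "loop2 u ds t acc G tot = loop u ds t (tunion acc (ttrunc t)) G (padd tot G)"

lemma mass_loop:
  assumes "j > 0" "Suc m + j = k" "twf (Suc m) 0 T" "\<forall>d\<in>set ds. d > 0" "twf m 0 acc"
    "loop (replicate j False) ds T acc G tot = (acc', tot')"
  shows "twf m 0 acc' \<and> mass k (weight k h e (Suc j)) acc' tot'
    \<le> mass k (weight k h e (Suc j)) acc tot + wsum ds (\<lambda>s. mass k (peeled k h e j s) T G)"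
  using assms(3-6)
proof (induction ds arbitrary: T acc G tot)
  case (Cons d ds)
  define u where "u = replicate j False"
  define T' where "T' = tshift d u u [] T"
  define G' where "G' = pshift d u (padd G (thits T))"
  have d: "d > 0" "\<forall>d\<in>set ds. d > 0" using Cons.prems by auto
  have step: "mass k (peeled k h e j s) T' G' \<le> mass k (peeled k h e j (Suc s)) T G / of_int d" for s
    unfolding T'_def G'_def u_def by (rule mass_tshift) (use assms(1,2) Cons.prems(1) d in auto)
  have twf: "twf (Suc m) 0 T'" unfolding T'_def using Cons.prems(1) by (rule twf_tshift)
  have "twf m 0 (tunion acc (ttrunc T'))" using Cons.prems(3) twf by (simp add: twf_ttrunc)
  moreover have "loop u ds T' (tunion acc (ttrunc T')) G' (padd tot G') = (acc', tot')"
    using Cons.prems(4) by (simp add: u_def T'_def G'_def)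
  ultimately have IH: "twf m 0 acc'" "mass k (weight k h e (Suc j)) acc' tot' \<le> mass k (weight k h e (Suc j)) (tunion acc (ttrunc T')) (padd tot G')
      + wsum ds (\<lambda>s. mass k (peeled k h e j s) T' G')"
    using Cons.IH[OF twf d(2), of "tunion acc (ttrunc T')" G' "padd tot G'"] by (auto simp: u_def)
  have "wsum ds (\<lambda>s. mass k (peeled k h e j s) T' G') \<le> wsum ds (\<lambda>s. mass k (peeled k h e j (Suc s)) T G) / of_int d"
    unfolding wsum_divide[symmetric] using step d(2) by (intro wsum_mono) auto
  moreover have "mass k (weight k h e (Suc j)) (tunion acc (ttrunc T')) (padd tot G')
      \<le> mass k (weight k h e (Suc j)) acc tot + mass k (peeled k h e j 0) T' G'"
  proof -
    have "weight k h e (Suc j) (insert (Suc m) S) = weight k h e (Suc j) S" for S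
      using assms(1,2) by (intro weight_relevant) (auto simp: relevant_def)
    hence "tval (weight k h e (Suc j)) 0 {} (ttrunc T') \<le> tval (weight k h e (Suc j)) 0 {} T'"
      using twf by (intro tval_ttrunc weight_nonneg)
    moreover have "tval (weight k h e (Suc j)) 0 {} (tunion acc (ttrunc T')) \<le> tval (weight k h e (Suc j)) 0 {} acc + tval (weight k h e (Suc j)) 0 {} (ttrunc T')"
      by (intro tval_tunion weight_nonneg)
    ultimately show ?thesis by (simp add: mass_def pval_padd peeled_0)
  qed
  ultimately show ?case using IH step[of 0] by (simp add: add_divide_distrib)
qed auto

lemma mass_level:
  assumes "j > 0" "Suc m + j = k" "twf (Suc m) 0 T"
    "loop (replicate j False) (multiples M j) T (ttrunc T) G G = (acc', tot')"
  shows "twf m 0 acc'" "mass k (weight k h e (Suc j)) acc' tot' \<le> mass k (weight k h e j) T G"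
proof -
  have *: "twf m 0 (ttrunc T)" using assms(3) by (rule twf_ttrunc)
  note L = mass_loop[OF assms(1-3) multiples_pos[OF assms(1)] * assms(4), of h e]
  thus "twf m 0 acc'" by blast
  have "weight k h e (Suc j) (insert (Suc m) S) = weight k h e (Suc j) S" for S
    using assms(1,2) by (intro weight_relevant) (auto simp: relevant_def)
  hence "tval (weight k h e (Suc j)) 0 {} (ttrunc T) \<le> tval (weight k h e (Suc j)) 0 {} T"
    using assms(3) by (intro tval_ttrunc weight_nonneg)
  hence "mass k (weight k h e (Suc j)) (ttrunc T) G \<le> mass k (peeled k h e j 0) T G" by (simp add: mass_def peeled_0)
  with L have "mass k (weight k h e (Suc j)) acc' tot' \<le> mass k (peeled k h e j 0) T G + wsum (multiples M j) (\<lambda>s. mass k (peeled k h e j s) T G)"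
    by linarith
  also have "\<dots> = (\<Sum>s\<le>M div j. mass k (peeled k h e j s) T G / (real j ^ s * fact s))"
    by (rule wsum_multiples[OF assms(1)])
  also have "\<dots> = mass k (\<lambda>S i. \<Sum>s\<le>M div j. peeled k h e j s S i / (real j ^ s * fact s)) T G"
    by (simp add: mass_def tval_sum pval_sum sum.distrib add_divide_distrib)
  also have "\<dots> \<le> mass k (weight k h e j) T G"
    unfolding mass_def by (intro add_mono tval_mono pval_mono sum_peeled_le_weight assms(1))
  finally show "mass k (weight k h e (Suc j)) acc' tot' \<le> mass k (weight k h e j) T G" .
qed

text \<open>
  The same loop for a single polynomial, whose set of sums does not change any more. This
  is the case for the hits at all times, and for the misses as soon as \<open>j\<close> exceeds \<open>k\<close>.
\<close>

fun ploop and ploop2 where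
  "ploop u [] g tot = tot"
| "ploop u (d # ds) g tot = ploop2 u ds (pshift d u g) tot"
| "ploop2 u ds g tot = ploop u ds g (padd tot g)"

lemma pval_ploop:
  assumes "\<And>s. peeled k h e j s (extend j S) = peeled k h e j s S" "\<forall>d\<in>set ds. d > 0"
  shows "pval (weight k h e (Suc j) S) 0 (ploop (replicate j False) ds g tot)
    \<le> pval (weight k h e (Suc j) S) 0 tot + wsum ds (\<lambda>s. pval (peeled k h e j s S) 0 g)"
  using assms(2)
proof (induction ds arbitrary: g tot)
  case (Cons d ds)
  define g' where "g' = pshift d (replicate j False) g"
  have d: "d > 0" "\<forall>d\<in>set ds. d > 0" using Cons.prems by auto
  have step: "pval (peeled k h e j s S) 0 g' \<le> pval (peeled k h e j (Suc s) S) 0 g / of_int d" for s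
  proof -
    have "of_int d * pval (peeled k h e j s S) 0 g' \<le> pval (peeled k h e j (Suc s) S) 0 g"
      unfolding g'_def using peeled_Suc[of k h e j s S] assms(1) by (intro pval_pshift peeled_nonneg d) simp
    thus ?thesis using d by (simp add: le_divide_eq mult.commute)
  qed
  have "wsum ds (\<lambda>s. pval (peeled k h e j s S) 0 g') \<le> wsum ds (\<lambda>s. pval (peeled k h e j (Suc s) S) 0 g) / of_int d"
    unfolding wsum_divide[symmetric] using step d(2) by (intro wsum_mono) auto
  thus ?case using Cons.IH[OF d(2), of g' "padd tot g'"] step[of 0]
    by (simp add: g'_def[symmetric] pval_padd peeled_0 add_divide_distrib)
qed auto

lemma pval_sum_peeled:
  assumes "j > 0"
  shows "pval (peeled k h e j 0 S) 0 p + wsum (multiples M j) (\<lambda>s. pval (peeled k h e j s S) 0 p) \<le> pval (weight k h e j S) 0 p"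
proof -
  have "pval (peeled k h e j 0 S) 0 p + wsum (multiples M j) (\<lambda>s. pval (peeled k h e j s S) 0 p)
      = (\<Sum>s\<le>M div j. pval (peeled k h e j s S) 0 p / (real j ^ s * fact s))"
    by (rule wsum_multiples[OF assms])
  also have "\<dots> = pval (\<lambda>i. \<Sum>s\<le>M div j. peeled k h e j s S i / (real j ^ s * fact s)) 0 p"
    by (simp add: pval_sum)
  also have "\<dots> \<le> pval (weight k h e j S) 0 p" by (intro pval_mono sum_peeled_le_weight assms)
  finally show ?thesis .
qed

lemma pval_plevel:
  assumes "j > 0" "S = {} \<or> k \<in> S"
  shows "pval (weight k h e (Suc j) S) 0 (ploop (replicate j False) (multiples M j) p p) \<le> pval (weight k h e j S) 0 p"
proof -
  have "peeled k h e j s (extend j S) = peeled k h e j s S" for s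
    using assms(2) peeled_hit[of k "extend j S" S] by (auto simp: extend_def)
  from pval_ploop[of k h e j S, OF this multiples_pos[OF assms(1)], of M p p] pval_sum_peeled[OF assms(1), of k h e S p M]
  show ?thesis by (simp add: peeled_0)
qed

fun tail where
  "tail u [] p G = (p, G)"
| "tail u (ds # dss) p G = tail (False # u) dss (ploop u ds p p) (ploop u ds G G)"

lemma pval_tail:
  assumes "0 < j" "j \<le> N" "tail (replicate j False) (map (multiples M) [j..<N]) p G = (p', G')"
  shows "pval (weight k h e N {}) 0 p' + pval (weight k h e N {k}) 0 G' \<le> pval (weight k h e j {}) 0 p + pval (weight k h e j {k}) 0 G"
  using assms
proof (induction "N - j" arbitrary: j p G)
  case (Suc n)
  hence "[j..<N] = j # [Suc j..<N]" by (intro upt_conv_Cons) simp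
  hence "tail (replicate (Suc j) False) (map (multiples M) [Suc j..<N])
    (ploop (replicate j False) (multiples M j) p p) (ploop (replicate j False) (multiples M j) G G) = (p', G')"
    using Suc.prems by simp
  moreover have "n = N - Suc j" "0 < Suc j" "Suc j \<le> N" using Suc.hyps(2) by auto
  ultimately show ?case
    using Suc.hyps(1)[of "Suc j"] pval_plevel[OF Suc.prems(1), of "{}" k h e M p]
      pval_plevel[OF Suc.prems(1), of "{k}" k h e M G] by fastforce
qed simp

text \<open>
  The trie loses one level per cycle length and is down to a single bit, for the sum 0, when \<open>j = k\<close>.
  A \<open>k\<close>-cycle is then a hit, and without one no hit is possible any more.
\<close>

fun run and run2 where
  "run u [] T G = (PE, PE)"
| "run u (ds # dss) TE G = tail (False # u) dss PE (ploop u ds G G)"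
| "run u (ds # dss) (TB p q) G = tail (False # u) dss q (ploop u ds (padd G q) G)"
| "run u (ds # dss) (TN l r) G = run2 u dss (loop u ds (TN l r) (ttrunc (TN l r)) G G)"
| "run2 u dss (T, G) = run (False # u) dss T G"

lemma mass_last_level:
  assumes "k > 0"
  shows "pval (weight k h e (Suc k) {}) 0 q + pval (weight k h e (Suc k) {k}) 0 (ploop (replicate k False) (multiples M k) (padd G q) G)
    \<le> mass k (weight k h e k) (TB p q) G"
proof -
  have "peeled k h e k s (extend k {k}) = peeled k h e k s {k}" for s
    using peeled_hit[of k "extend k {k}" "{k}"] by (auto simp: extend_def)
  note P = pval_ploop[of k h e k "{k}", OF this multiples_pos[OF assms], of M "padd G q" G]
  have "wsum (multiples M k) (\<lambda>s. pval (peeled k h e k s {k}) 0 q) = wsum (multiples M k) (\<lambda>s. pval (peeled k h e k s {0}) 0 q)"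
    using peeled_Suc_hit[of k k "{k}" "{0}"] by (intro wsum_cong) (simp add: extend_def)
  moreover have "weight k h e (Suc k) {} = weight k h e (Suc k) {0}"
    using assms by (intro weight_relevant) (auto simp: relevant_def)
  ultimately show ?thesis
    using P pval_sum_peeled[OF assms, of k h e "{k}" G M] pval_sum_peeled[OF assms, of k h e "{0}" q M] pval_nonneg[of "weight k h e k {}" 0 p, OF weight_nonneg]
    by (simp add: mass_def pval_padd wsum_add peeled_0)
qed

lemma mass_run:
  assumes "0 < j" "j \<le> k" "twf (k - j) 0 T" "j \<le> N"
    "run (replicate j False) (map (multiples M) [j..<N]) T G = (p', G')"
  shows "pval (weight k h e N {}) 0 p' + pval (weight k h e N {k}) 0 G' \<le> mass k (weight k h e j) T G"
  using assms
proof (induction "N - j" arbitrary: j T G)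
  case 0
  thus ?case by (auto simp: mass_def intro!: add_nonneg_nonneg tval_nonneg pval_nonneg weight_nonneg)
next
  case (Suc n)
  hence N: "[j..<N] = j # [Suc j..<N]" by (intro upt_conv_Cons) simp
  have jN: "Suc j \<le> N" using Suc.hyps(2) by simp
  show ?case
  proof (cases T)
    case TE
    hence "tail (replicate (Suc j) False) (map (multiples M) [Suc j..<N]) PE (ploop (replicate j False) (multiples M j) G G) = (p', G')"
      using Suc.prems N by simp
    from pval_tail[OF _ _ this, of k h e] pval_plevel[OF Suc.prems(1), of "{k}" k h e M G]
    show ?thesis using TE jN by (simp add: mass_def)
  next
    case (TB p q)
    hence "j = k" using Suc.prems by simp
    hence "tail (replicate (Suc k) False) (map (multiples M) [Suc k..<N]) q (ploop (replicate k False) (multiples M k) (padd G q) G) = (p', G')"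
      using TB Suc.prems N by simp
    from pval_tail[OF _ _ this, of k h e] mass_last_level[of k h e q M G p]
    show ?thesis using TB \<open>j = k\<close> Suc.prems jN by simp
  next
    case (TN l r)
    obtain T' G1 where L: "loop (replicate j False) (multiples M j) T (ttrunc T) G G = (T', G1)" by fastforce
    hence run: "run (replicate (Suc j) False) (map (multiples M) [Suc j..<N]) T' G1 = (p', G')"
      using TN Suc.prems N by simp
    have "j \<noteq> k" using TN Suc.prems(3) by auto
    then obtain m where m: "Suc m + j = k" "k - j = Suc m" "k - Suc j = m"
        using Suc.prems(2) by (metis Suc_diff_Suc diff_Suc_1 diff_Suc_eq_diff_pred le_add_diff_inverse2 le_neq_implies_less)
      note lev = mass_level[OF Suc.prems(1) m(1) Suc.prems(3)[unfolded m(2)] L]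
      have "pval (weight k h e N {}) 0 p' + pval (weight k h e N {k}) 0 G' \<le> mass k (weight k h e (Suc j)) T' G1"
        by (rule Suc.hyps(1)[OF _ _ _ _ _ run]) (use Suc.hyps(2) Suc.prems m lev(1) in auto)
      also have "\<dots> \<le> mass k (weight k h e j) T G" by (rule lev(2))
      finally show ?thesis .
  qed
qed

section \<open>From weights to proportions\<close>

fun chain :: "bool list \<Rightarrow> pol \<Rightarrow> trie" where "chain [] p = TB p PE" | "chain (b # z) p = TN (chain z p) TE"
fun tinit :: "bool list \<Rightarrow> pol \<Rightarrow> trie" where "tinit [] p = TE" | "tinit [b] p = TB PE p" | "tinit (b # c # z) p = TN TE (chain z p)"
fun pad :: "bool list \<Rightarrow> quad \<Rightarrow> pol" where "pad [] x = PV x PE" | "pad (b # z) x = PZ (pad z x)"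

lemma tval_chain: "tval f i X (chain z p) = pval (f X) 0 p"
  by (induction z arbitrary: i) auto

lemma tval_tinit: "z \<noteq> [] \<Longrightarrow> tval f 0 {} (tinit z p) = pval (f {0}) 0 p"
  by (cases "(z, p)" rule: tinit.cases) (auto simp: tval_chain)

lemma twf_chain: "m = i + length z \<Longrightarrow> twf m i (chain z p)"
  by (induction z arbitrary: i) auto

lemma twf_tinit: "twf (length z - 1) 0 (tinit z p)"
  by (cases "(z, p)" rule: tinit.cases) (auto simp: twf_chain)

lemma pval_pad: "pval v i (pad z x) = of_int (qval x) * v (i + length z)"
  by (induction z arbitrary: i) auto

definition levels :: "int list list" where
  "levels = map (multiples 70) [1..<71]"

definition dp :: "nat \<Rightarrow> nat \<Rightarrow> quad \<Rightarrow> pol \<times> pol" where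
  "dp k N x = run [False] levels (tinit (replicate k False) (pad (replicate N False) x)) PE"

fun phd where "phd PE = 0" | "phd (PZ p) = 0" | "phd (PV x p) = qval x"
fun ptl where "ptl PE = PE" | "ptl (PZ p) = p" | "ptl (PV x p) = p"

lemma pval_ge_coeff:
  assumes "\<And>i. 0 \<le> v i"
  shows "of_int (phd ((ptl ^^ e) p)) * v (i + e) \<le> pval v i p"
proof (induction e arbitrary: i p)
  case 0
  have "0 \<le> pval v (Suc i) q" for q using assms by (rule pval_nonneg)
  thus ?case by (cases p) (auto simp: pval_nonneg assms)
next
  case (Suc e)
  show ?case
  proof (cases p)
    case PE
    have "(ptl ^^ e) PE = PE" by (induction e) auto
    thus ?thesis using PE by (simp add: funpow_swap1)
  next
    case (PZ q) thus ?thesis using Suc[of q "Suc i"] by (simp add: funpow_swap1)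
  next
    case (PV x q)
    have "0 \<le> of_int (qval x) * v i" using assms qval_nonneg by simp
    thus ?thesis using Suc[of q "Suc i"] PV by (simp add: funpow_swap1)
  qed
qed

text \<open>
  When all cycle lengths up to 70 are exhausted, a state is complete if and only if it has no free
  point. For \<open>n = N - e\<close> this is the coefficient at \<open>e\<close>.
\<close>

lemma dp_lower:
  assumes "dp k N x = (p, G)" "0 < k" "k \<le> 70" "e \<le> N"
  shows "of_int (phd ((ptl ^^ e) p)) \<le> of_int (qval x) * \<beta> k False 1 (N - e) {0}"
    and "of_int (phd ((ptl ^^ e) G)) \<le> of_int (qval x) * \<beta> k True 1 (N - e) {0}"
proof -
  have R: "pval (weight k h e 71 {}) 0 p + pval (weight k h e 71 {k}) 0 G \<le> of_int (qval x) * \<beta> k h 1 (N - e) {0}" for h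
  proof -
    let ?T = "tinit (replicate k False) (pad (replicate N False) x)"
    have "run (replicate 1 False) (map (multiples 70) [1..<71]) ?T PE = (p, G)"
      using assms(1) by (simp add: dp_def levels_def)
    from mass_run[OF _ _ _ _ this, of k h e] twf_tinit[of "replicate k False"] assms(2,3)
    have "pval (weight k h e 71 {}) 0 p + pval (weight k h e 71 {k}) 0 G \<le> mass k (weight k h e 1) ?T PE" by simp
    also have "\<dots> = of_int (qval x) * \<beta> k h 1 (N - e) {0}"
      using assms(2,4) tval_tinit[of "replicate k False"] by (simp add: mass_def pval_pad weight_def)
    finally show ?thesis .
  qed
  have "weight k False e 71 {} (0 + e) = 1" "weight k True e 71 {k} (0 + e) = 1"
    by (auto simp: weight_def \<beta>.simps)
  hence "of_int (phd ((ptl ^^ e) p)) \<le> pval (weight k False e 71 {}) 0 p" "of_int (phd ((ptl ^^ e) G)) \<le> pval (weight k True e 71 {k}) 0 G"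
    using pval_ge_coeff[of "weight k False e 71 {}" e p 0] pval_ge_coeff[of "weight k True e 71 {k}" e G 0] weight_nonneg by auto
  thus "of_int (phd ((ptl ^^ e) p)) \<le> of_int (qval x) * \<beta> k False 1 (N - e) {0}"
    "of_int (phd ((ptl ^^ e) G)) \<le> of_int (qval x) * \<beta> k True 1 (N - e) {0}"
    using R[of False] R[of True] pval_nonneg[of "weight k False e 71 {k}" 0 G, OF weight_nonneg] pval_nonneg[of "weight k True e 71 {}" 0 p, OF weight_nonneg]
    by linarith+
qed

lemma fixes_k_subset_iff_hits: "fixes_k_subset n k p \<longleftrightarrow> hits k {0} p {1..n}"
  by (auto simp: fixes_k_subset_def hits_def)

lemma i_prop_eq_\<beta>: "i_prop n k = \<beta> k True 1 n {0}" and one_minus_i_prop_eq_\<beta>: "1 - i_prop n k = \<beta> k False 1 n {0}"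
proof -
  have long: "long_perms k 1 {0} h {1..n} = {p. p permutes {1..n} \<and> hits k {0} p {1..n} = h}" for h
  proof -
    have "1 \<le> card (orbit p x)" if "p permutes {1..n}" for p :: "nat \<Rightarrow> nat" and x
      using finite_orbit[OF self_in_orbit[OF that]] self_in_orbit[OF that]
      by (metis One_nat_def Suc_leI card_gt_0_iff empty_iff finite_atLeastAtMost)
    thus ?thesis by (auto simp: long_perms_def)
  qed
  have tot: "card {p. p permutes {1..n}} = fact n" by (simp add: card_permutations)
  define P where "P h = {p. p permutes {1..n} \<and> hits k {0} p {1..n} = h}" for h
  have card: "real (card (P h)) = fact n * \<beta> k h 1 n {0}" for h
    using card_long_perms[of "{1..n}" 1 k "{0}" h] unfolding long P_def by simp
  have "{p. p permutes {1..n} \<and> fixes_k_subset n k p} = P True"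
    by (simp add: fixes_k_subset_iff_hits P_def)
  hence "i_prop n k = real (card (P True)) / fact n" unfolding i_prop_def tot by simp
  thus *: "i_prop n k = \<beta> k True 1 n {0}" unfolding card by simp
  have "{p. p permutes {1..n}} = P True \<union> P False" by (auto simp: P_def)
  hence "fact n = card (P True \<union> P False)" using tot by (simp only:)
  also have "\<dots> = card (P True) + card (P False)"
    unfolding P_def using finite_permutations[of "{1..n}"] by (intro card_Un_disjoint) auto
  finally have "real (fact n) = fact n * \<beta> k True 1 n {0} + fact n * \<beta> k False 1 n {0}"
    using card[of True] card[of False] by (simp only: of_nat_add)
  hence "(fact n :: real) * 1 = fact n * (\<beta> k True 1 n {0} + \<beta> k False 1 n {0})" by (simp add: algebra_simps)
  hence "1 = \<beta> k True 1 n {0} + \<beta> k False 1 n {0}" unfolding mult_cancel_left by simp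
  thus "1 - i_prop n k = \<beta> k False 1 n {0}" using * by simp
qed

text \<open>
  \<open>x\<close> is the initial weight, that is, the number of units of weight in 1. The \<open>e\<close>-th pair of the list
  claims \<open>l / D \<le> i(N - e, k) \<le> u / D\<close>. The lower bound comes from the hits and the upper bound from
  the misses.
\<close>

fun certifies :: "int \<Rightarrow> int \<Rightarrow> (int \<times> int) list \<Rightarrow> pol \<times> pol \<Rightarrow> bool" where
  "certifies D x [] pG \<longleftrightarrow> True"
| "certifies D x ((l, u) # bs) (p, G) \<longleftrightarrow>
     l * x \<le> D * phd G \<and> (D - u) * x \<le> D * phd p \<and> certifies D x bs (ptl p, ptl G)"

lemma certifies_nth:
  assumes "certifies D x bs (p, G)" "e < length bs" "bs ! e = (l, u)"
  shows "l * x \<le> D * phd ((ptl ^^ e) G) \<and> (D - u) * x \<le> D * phd ((ptl ^^ e) p)"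
  using assms
proof (induction e arbitrary: bs p G)
  case 0 thus ?case by (cases bs) auto
next
  case (Suc e)
  then obtain l' u' bs' where "bs = (l', u') # bs'" by (cases bs) auto
  thus ?case using Suc.IH[of bs' "ptl p" "ptl G"] Suc.prems by (simp add: funpow_swap1)
qed

lemma i_prop_bounds:
  assumes "certifies D (qval x) bs (dp k N x)" "0 < k" "k \<le> 70" "e \<le> N" "e < length bs" "bs ! e = (l, u)" "0 < D" "0 < qval x"
  shows "of_int l / of_int D \<le> i_prop (N - e) k" "i_prop (N - e) k \<le> of_int u / of_int D"
proof -
  obtain p G where dp: "dp k N x = (p, G)" by fastforce
  note c = certifies_nth[OF assms(1)[unfolded dp] assms(5,6)]
  note L = dp_lower[OF dp assms(2-4)]
  have D: "0 < (of_int D :: real)" "0 < (of_int (qval x) :: real)" using assms(7,8) by auto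
  have "of_int l * of_int (qval x) \<le> (of_int D :: real) * of_int (phd ((ptl ^^ e) G))"
    using c by (metis of_int_le_iff of_int_mult)
  also have "\<dots> \<le> of_int D * (of_int (qval x) * i_prop (N - e) k)"
    using L(2) D by (intro mult_left_mono) (auto simp: i_prop_eq_\<beta>)
  finally have "of_int l * of_int (qval x) \<le> (of_int D * i_prop (N - e) k) * of_int (qval x)" by (simp add: mult_ac)
  hence "of_int l \<le> of_int D * i_prop (N - e) k" using D(2) by (rule mult_right_le_imp_le)
  thus "of_int l / of_int D \<le> i_prop (N - e) k" using D by (simp add: divide_le_eq mult.commute)
  have "of_int (D - u) * of_int (qval x) \<le> (of_int D :: real) * of_int (phd ((ptl ^^ e) p))"
    using c by (metis of_int_le_iff of_int_mult)
  also have "\<dots> \<le> of_int D * (of_int (qval x) * (1 - i_prop (N - e) k))"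
    using L(1) D by (intro mult_left_mono) (auto simp: one_minus_i_prop_eq_\<beta>)
  finally have "of_int (D - u) * of_int (qval x) \<le> (of_int D * (1 - i_prop (N - e) k)) * of_int (qval x)" by (simp add: mult_ac)
  hence "of_int (D - u) \<le> of_int D * (1 - i_prop (N - e) k)" using D(2) by (rule mult_right_le_imp_le)
  hence "of_int D * i_prop (N - e) k \<le> of_int u" by (simp add: algebra_simps)
  thus "i_prop (N - e) k \<le> of_int u / of_int D" using D by (simp add: le_divide_eq mult.commute)
qed

lemma i_prop_complement:
  assumes "k \<le> n" shows "i_prop n k = i_prop n (n - k)"
proof -
  have "fixes_k_subset n (n - k) p" if "fixes_k_subset n k p" "p permutes {1..n}" "k \<le> n" for p k
  proof -
    from that obtain S where S: "S \<subseteq> {1..n}" "card S = k" "p ` S = S" by (auto simp: fixes_k_subset_def)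
    have "p ` ({1..n} - S) = {1..n} - S" using image_Diff_invariant[OF that(2) S(3)] .
    moreover have "card ({1..n} - S) = n - k" using S by (simp add: card_Diff_subset finite_subset[OF S(1)])
    ultimately show ?thesis unfolding fixes_k_subset_def by (intro exI[of _ "{1..n} - S"]) auto
  qed
  from this[of k] this[of "n - k"] assms
  have "{p. p permutes {1..n} \<and> fixes_k_subset n k p} = {p. p permutes {1..n} \<and> fixes_k_subset n (n - k) p}"
    by auto
  thus ?thesis by (simp add: i_prop_def)
qed

section \<open>Evaluation by rewriting\<close>

text \<open>
  Bisection on the bits of the index. The resulting conjunctions are balanced, and a balanced
  conjunction splits into rewrite rules much faster than a long chain. Only the length of the list
  counts; seven bits cover all divisors up to 70.
\<close>

primrec range_all :: "bool list \<Rightarrow> int \<Rightarrow> (int \<Rightarrow> bool) \<Rightarrow> int \<Rightarrow> bool" where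
  "range_all [] d P i \<longleftrightarrow> (i < d \<longrightarrow> P i)"
| "range_all (b # z) d P i \<longleftrightarrow> range_all z d P (2 * i) \<and> range_all z d P (2 * i + 1)"

lemma range_allI: "(\<And>i. P i) \<Longrightarrow> range_all z d P i"
  by (induction z arbitrary: i) auto

lemma steps:
  "range_all [True, True, True, True, True, True, True] d (\<lambda>r.
     step0 (Q d r x) = qnext d (4 * r) x \<and> step1 (Q d r x) = qnext d (4 * r + 1) x \<and>
     step2 (Q d r x) = qnext d (4 * r + 2) x \<and> step3 (Q d r x) = qnext d (4 * r + 3) x) 0"
  by (rule range_allI) simp

lemmas tabulate = range_all.simps qnext_def
  arith_simps arith_extra_simps arith_special rel_simps diff_numeral_special numeral_One one_add_one
  mult_1 mult_1_right diff_self diff_0_right if_True if_False simp_thms num.simps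

text \<open>
  The transitions of the division automata. The divisors are the multiples \<open>c * j\<close> up to 70.
\<close>

lemmas step_table =
  steps[of 1, simplified tabulate] steps[of 2, simplified tabulate] steps[of 3, simplified tabulate]
  steps[of 4, simplified tabulate] steps[of 5, simplified tabulate] steps[of 6, simplified tabulate]
  steps[of 7, simplified tabulate] steps[of 8, simplified tabulate] steps[of 9, simplified tabulate]
  steps[of 10, simplified tabulate] steps[of 11, simplified tabulate] steps[of 12, simplified tabulate]
  steps[of 13, simplified tabulate] steps[of 14, simplified tabulate] steps[of 15, simplified tabulate]
  steps[of 16, simplified tabulate] steps[of 17, simplified tabulate] steps[of 18, simplified tabulate]
  steps[of 19, simplified tabulate] steps[of 20, simplified tabulate] steps[of 21, simplified tabulate]
  steps[of 22, simplified tabulate] steps[of 23, simplified tabulate] steps[of 24, simplified tabulate]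
  steps[of 25, simplified tabulate] steps[of 26, simplified tabulate] steps[of 27, simplified tabulate]
  steps[of 28, simplified tabulate] steps[of 29, simplified tabulate] steps[of 30, simplified tabulate]
  steps[of 31, simplified tabulate] steps[of 32, simplified tabulate] steps[of 33, simplified tabulate]
  steps[of 34, simplified tabulate] steps[of 35, simplified tabulate] steps[of 36, simplified tabulate]
  steps[of 37, simplified tabulate] steps[of 38, simplified tabulate] steps[of 39, simplified tabulate]
  steps[of 40, simplified tabulate] steps[of 41, simplified tabulate] steps[of 42, simplified tabulate]
  steps[of 43, simplified tabulate] steps[of 44, simplified tabulate] steps[of 45, simplified tabulate]
  steps[of 46, simplified tabulate] steps[of 47, simplified tabulate] steps[of 48, simplified tabulate]
  steps[of 49, simplified tabulate] steps[of 50, simplified tabulate] steps[of 51, simplified tabulate]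
  steps[of 52, simplified tabulate] steps[of 53, simplified tabulate] steps[of 54, simplified tabulate]
  steps[of 55, simplified tabulate] steps[of 56, simplified tabulate] steps[of 57, simplified tabulate]
  steps[of 58, simplified tabulate] steps[of 59, simplified tabulate] steps[of 60, simplified tabulate]
  steps[of 61, simplified tabulate] steps[of 62, simplified tabulate] steps[of 63, simplified tabulate]
  steps[of 64, simplified tabulate] steps[of 65, simplified tabulate] steps[of 66, simplified tabulate]
  steps[of 67, simplified tabulate] steps[of 68, simplified tabulate] steps[of 69, simplified tabulate]
  steps[of 70, simplified tabulate]

definition encloses :: "int \<Rightarrow> nat \<Rightarrow> nat \<Rightarrow> quad \<Rightarrow> (int \<times> int) list \<Rightarrow> bool" where
  "encloses D k N x bs \<longleftrightarrow> certifies D (qval x) bs (dp k N x)"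

lemma levels_eq:
  "levels =
    [[1, 2, 3, 4, 5, 6, 7, 8, 9, 10, 11, 12, 13, 14, 15, 16, 17, 18, 19, 20, 21, 22, 23, 24, 25, 26, 27, 28,
     29, 30, 31, 32, 33, 34, 35, 36, 37, 38, 39, 40, 41, 42, 43, 44, 45, 46, 47, 48, 49, 50, 51, 52, 53, 54,
     55, 56, 57, 58, 59, 60, 61, 62, 63, 64, 65, 66, 67, 68, 69, 70], [2, 4, 6, 8, 10, 12, 14, 16, 18, 20, 22,
     24, 26, 28, 30, 32, 34, 36, 38, 40, 42, 44, 46, 48, 50, 52, 54, 56, 58, 60, 62, 64, 66, 68, 70], [3, 6,
     9, 12, 15, 18, 21, 24, 27, 30, 33, 36, 39, 42, 45, 48, 51, 54, 57, 60, 63, 66, 69], [4, 8, 12, 16, 20,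
     24, 28, 32, 36, 40, 44, 48, 52, 56, 60, 64, 68], [5, 10, 15, 20, 25, 30, 35, 40, 45, 50, 55, 60, 65, 70],
     [6, 12, 18, 24, 30, 36, 42, 48, 54, 60, 66], [7, 14, 21, 28, 35, 42, 49, 56, 63, 70], [8, 16, 24, 32, 40,
     48, 56, 64], [9, 18, 27, 36, 45, 54, 63], [10, 20, 30, 40, 50, 60, 70], [11, 22, 33, 44, 55, 66], [12,
     24, 36, 48, 60], [13, 26, 39, 52, 65], [14, 28, 42, 56, 70], [15, 30, 45, 60], [16, 32, 48, 64], [17, 34,
     51, 68], [18, 36, 54], [19, 38, 57], [20, 40, 60], [21, 42, 63], [22, 44, 66], [23, 46, 69], [24, 48],
     [25, 50], [26, 52], [27, 54], [28, 56], [29, 58], [30, 60], [31, 62], [32, 64], [33, 66], [34, 68], [35,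
     70], [36], [37], [38], [39], [40], [41], [42], [43], [44], [45], [46], [47], [48], [49], [50], [51],
     [52], [53], [54], [55], [56], [57], [58], [59], [60], [61], [62], [63], [64], [65], [66], [67], [68],
     [69], [70]]"
  by code_simp

lemma replicate_numeral: "replicate (numeral w) x = x # replicate (pred_numeral w) x"
  by (simp add: numeral_eq_Suc)

lemma replicate_one: "replicate 1 x = [x]"
  by simp

lemma funpow_numeral: "(f ^^ numeral w) x = f ((f ^^ pred_numeral w) x)"
  by (simp add: numeral_eq_Suc)

lemma funpow_zero: "(f ^^ 0) x = x"
  by simp

lemmas dp_rules = encloses_def dp_def levels_eq run.simps run2.simps tail.simps loop.simps loop2.simps ploop.simps ploop2.simps
  tinit.simps chain.simps pad.simps tshift.simps revonto.simps thits.simps ttrunc.simps tunion.simps tnode.simps tright.simps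
  tleaf0.simps tleaf1.simps pshift.simps pdiv.simps pquot.simps pzero.simps padd.simps qdiv.simps q0.simps inc.simps add.simps adc.simps
  step_table replicate_numeral replicate_0 replicate_one funpow_numeral funpow_zero pred_numeral_simps BitM.simps

text \<open>
  Bounds for \<open>i(70, k)\<close>, \<open>i(69, k)\<close>, ..., \<open>i(2k, k)\<close> in multiples of \<open>10^-6\<close>. The unit of weight is
  chosen for each \<open>k\<close> so that the accumulated rounding errors stay below half of the distances to
  the values for \<open>k - 1\<close> and \<open>k + 1\<close>, the two close pairs apart. A coarser unit also keeps the tables smaller, because states
  with less than one unit of weight are lost.
\<close>

lemma
  shows enclosure_1: "encloses 1000000 1 70 ((D0 ^^ 5) (D2 E))
   [(597656,662110), (598144,661622), (598144,662598), (598632,660645), (600097,660157), (601074,661622),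
    (601074,661622), (602050,659668), (602539,659180), (602539,661133), (602539,660645), (602539,658692),
    (602050,658692), (604980,658692), (603027,657227), (604980,654786), (604003,656739), (605468,655274),
    (605957,654297), (605468,653809), (605957,654786), (607421,653809), (607910,652833), (606933,652344),
    (609375,652344), (607910,650391), (609375,650879), (610351,650391), (610839,649415), (611328,651368),
    (611328,650391), (612304,649903), (614257,648438), (612792,647461), (612792,647950), (616210,646973),
    (615722,645997), (617187,645508), (617187,644532), (616699,643555), (617675,645020), (619140,644043),
    (618164,643067), (617675,643067), (618164,643067), (618652,642579), (619628,641114), (621582,641602),
    (621582,640137), (624023,641114), (621582,639161), (623535,638184), (624023,638672), (625488,637696),
    (625000,637208), (625000,638184), (625976,636231), (627441,635743), (627441,634766), (626953,634278),
    (628906,634278), (629882,633790), (629394,633301), (629882,633301), (630859,632813), (632812,633790),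
    (624511,625000), (666503,666993), (500000,500000)]"
  and enclosure_2: "encloses 1000000 2 70 ((D0 ^^ 6) (D1 E))
   [(534912,569581), (535644,568848), (535644,568604), (536376,567872), (537353,567872), (538085,567627),
    (536621,567139), (538330,567627), (538574,566895), (538574,567627), (538330,567383), (538330,567139),
    (539550,567872), (539306,566407), (540283,565918), (540283,566163), (540527,566407), (540283,566163),
    (540527,565674), (541015,565918), (541259,564698), (540771,564698), (541503,564209), (541748,563721),
    (541992,564209), (542724,563721), (541503,563965), (542236,563233), (542724,563477), (543212,562989),
    (543212,562745), (543701,562012), (544433,561280), (544433,561768), (544189,562256), (544921,561524),
    (545166,561036), (545410,559815), (545166,559815), (546142,560303), (546875,559571), (546630,559327),
    (547363,559083), (546630,559815), (547363,558838), (547607,558106), (548095,558350), (548583,558106),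
    (548339,558106), (549316,557618), (549316,556885), (549072,556885), (550292,557129), (550537,556397),
    (550292,555909), (551025,555420), (551025,555420), (551513,555420), (551269,555176), (552001,554932),
    (552734,554932), (553222,554688), (549560,551026), (550781,552002), (577392,578125), (549804,550049),
    (416503,416749)]"
  and enclosure_3: "encloses 1000000 3 70 ((D0 ^^ 6) (D2 E))
   [(487548,504639), (487426,504761), (487548,504151), (487792,504395), (488037,504395), (488403,503663),
    (488403,503541), (488037,503541), (488647,504151), (488525,504273), (488647,503785), (489135,503418),
    (488647,503541), (489135,503296), (489379,503174), (489257,503418), (489379,503052), (489624,502808),
    (489501,502442), (489501,502198), (489379,502198), (489746,502198), (490112,502442), (490356,501587),
    (489868,501709), (490234,501221), (490844,501465), (490844,501343), (490844,501099), (491333,501221),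
    (491455,500977), (491333,500733), (491455,500977), (491455,500611), (491699,500123), (491699,500245),
    (492431,500367), (492309,500123), (492553,499878), (492431,499878), (493041,499268), (492797,499512),
    (492553,499268), (493164,499146), (493408,499024), (493652,499024), (493774,498780), (493652,498902),
    (493896,498780), (494018,498292), (494262,497925), (494262,497803), (494506,497681), (494628,497437),
    (494995,497437), (495117,497315), (495361,497559), (495849,497681), (493774,495728), (494140,495728),
    (494018,494996), (514038,514893), (499877,500489), (489990,490601), (362304,362671)]"
  and enclosure_4: "encloses 1000000 4 70 ((D0 ^^ 6) (D2 E))
   [(460083,477662), (461181,477540), (461181,477051), (460815,477417), (461547,477173), (461303,476441),
    (461181,476319), (461791,476685), (461669,476807), (462158,476685), (461669,476685), (461791,475831),
    (461791,476441), (461791,475831), (462036,475586), (462646,475464), (461914,475586), (462768,475586),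
    (462524,475464), (463256,475342), (462890,475098), (463500,475220), (463500,474976), (463623,474854),
    (463378,474366), (463745,474488), (463745,474366), (463623,474000), (464477,473755), (464477,474244),
    (464477,473633), (464355,473755), (464477,473633), (464843,473511), (464721,473511), (465209,472779),
    (465576,472901), (465942,472657), (465454,472535), (465698,472535), (466186,472168), (466552,472291),
    (465942,471680), (466552,472046), (466552,471680), (466918,471558), (466918,471436), (467163,471680),
    (467285,471070), (466918,471070), (467285,470826), (467651,471070), (468139,470704), (468017,470704),
    (466918,469117), (466674,468995), (466796,468628), (468750,470459), (484008,485840), (476806,478150),
    (467041,467896), (447631,448365), (337158,337891)]"
  and enclosure_5: "encloses 1000000 5 70 ((D0 ^^ 7) (D1 E))
   [(436584,445801), (436523,445679), (436950,445618), (436767,445435), (436828,445374), (437133,445313),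
    (437011,445252), (437133,445069), (437255,445374), (437438,445008), (437438,445069), (437438,444947),
    (437500,445069), (437744,444825), (437744,444581), (437805,444459), (437683,444581), (437927,444459),
    (437927,444397), (438171,444397), (438232,444153), (438049,444214), (438171,444275), (438232,444275),
    (438171,444092), (438415,443970), (438415,443909), (438537,443848), (438659,443970), (438964,443543),
    (438598,443665), (438720,443360), (439147,443421), (438964,443299), (439270,443299), (439331,443299),
    (439208,443055), (439208,443055), (439636,442994), (439575,442933), (439575,442933), (439636,442627),
    (439758,442872), (439758,442566), (439819,442566), (439941,442627), (440124,442627), (440185,442444),
    (440429,442566), (440490,442444), (439697,441468), (439453,441285), (439025,440552), (439758,441041),
    (440734,441895), (454040,455018), (448425,449341), (445312,446290), (433959,434876), (419250,419922),
    (312927,313416)]"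
  and enclosure_6: "encloses 1000000 6 70 ((D0 ^^ 7) (D1 E))
   [(420349,429200), (420532,429383), (420654,429078), (420532,428956), (420593,428589), (420837,428467),
    (420715,428650), (420837,428895), (420959,428589), (420959,428834), (421325,428589), (421020,428528),
    (421203,428528), (421203,428284), (421386,428101), (421203,427979), (421508,427857), (421630,427796),
    (421630,427918), (421508,427613), (421630,427918), (421813,427613), (421691,427857), (421875,427674),
    (421997,427613), (422241,427674), (422058,427247), (422058,427308), (422363,427247), (422607,427002),
    (422302,427002), (422790,427002), (422424,426819), (422790,426636), (422851,426880), (422973,426575),
    (422973,426453), (422912,426453), (423217,426514), (423034,426575), (423217,426453), (423339,426392),
    (423645,426392), (423522,426270), (423583,426148), (423645,426331), (423156,425477), (422973,425049),
    (422546,424805), (422973,424988), (423217,424927), (424926,426514), (435974,437317), (432128,433472),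
    (429748,430848), (422424,423401), (415832,416688), (396545,397461), (298278,299134)]"
  and enclosure_7: "encloses 1000000 7 70 ((D0 ^^ 9) (D1 E))
   [(408123,408799), (408138,408806), (408123,408776), (408138,408757), (408164,408768), (408157,408745),
    (408153,408741), (408172,408741), (408153,408753), (408206,408741), (408172,408726), (408195,408715),
    (408191,408722), (408206,408715), (408199,408711), (408210,408707), (408206,408719), (408214,408692),
    (408210,408711), (408222,408692), (408245,408688), (408233,408692), (408264,408688), (408256,408673),
    (408248,408669), (408264,408673), (408279,408658), (408279,408635), (408290,408654), (408290,408631),
    (408283,408619), (408298,408619), (408290,408627), (408290,408604), (408306,408604), (408332,408604),
    (408336,408608), (408386,408665), (408405,408658), (408477,408703), (408489,408696), (408481,408700),
    (407890,408104), (407760,407963), (407367,407555), (407554,407719), (407386,407567), (408149,408299),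
    (409294,409440), (419204,419335), (415779,415913), (415103,415223), (408927,409031), (406200,406285),
    (394939,395016), (379215,379296), (284980,285069)]"
  and enclosure_8: "encloses 1000000 8 70 ((D0 ^^ 9) (D2 E))
   [(397100,397437), (397096,397427), (397096,397431), (397100,397431), (397104,397418), (397102,397419),
    (397109,397412), (397115,397410), (397108,397414), (397113,397406), (397123,397406), (397127,397398),
    (397125,397400), (397123,397397), (397129,397395), (397130,397391), (397132,397381), (397134,397378),
    (397142,397385), (397146,397379), (397146,397376), (397159,397381), (397155,397372), (397155,397370),
    (397165,397372), (397159,397362), (397163,397355), (397167,397349), (397153,397337), (397155,397334),
    (397176,397341), (397195,397355), (397220,397383), (397239,397400), (397285,397433), (397304,397448),
    (397325,397471), (397281,397425), (396831,396952), (396680,396807), (396371,396489), (396387,396496),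
    (396257,396369), (396568,396670), (397058,397151), (398565,398657), (407201,407294), (404664,404738),
    (403858,403931), (400209,400288), (396488,396555), (390937,390999), (381961,382010), (364269,364319),
    (275499,275544)]"
  and enclosure_9: "encloses 1000000 9 70 ((D0 ^^ 8) (D2 E))
   [(384468,385758), (384506,385750), (384490,385750), (384498,385727), (384559,385735), (384529,385682),
    (384574,385697), (384582,385651), (384521,385674), (384597,385651), (384605,385674), (384567,385636),
    (384613,385659), (384605,385621), (384651,385636), (384651,385590), (384628,385605), (384628,385598),
    (384658,385590), (384674,385552), (384658,385552), (384696,385560), (384704,385560), (384712,385552),
    (384712,385506), (384750,385491), (384742,385514), (384803,385506), (384796,385544), (384864,385544),
    (384872,385544), (384902,385552), (384918,385567), (384910,385521), (384559,385117), (384437,384987),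
    (384140,384675), (384185,384659), (383987,384461), (384216,384682), (384254,384736), (385063,385468),
    (386207,386628), (394111,394494), (391792,392167), (391685,392037), (388496,388840), (386894,387230),
    (381752,382065), (378303,378571), (367179,367463), (351837,352051), (265556,265786)]"
  and enclosure_10: "encloses 1000000 10 70 ((D0 ^^ 9) (D1 E))
   [(376514,377183), (376537,377175), (376522,377179), (376522,377163), (376548,377156), (376544,377141),
    (376552,377125), (376548,377133), (376556,377125), (376567,377118), (376571,377118), (376586,377129),
    (376560,377106), (376598,377110), (376590,377106), (376594,377106), (376586,377099), (376602,377095),
    (376598,377080), (376605,377076), (376602,377080), (376621,377083), (376655,377087), (376659,377091),
    (376693,377106), (376728,377125), (376754,377137), (376773,377141), (376770,377148), (376747,377106),
    (376415,376774), (376304,376645), (376071,376404), (376060,376374), (375881,376191), (375980,376278),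
    (376007,376301), (376338,376614), (376880,377144), (378311,378548), (385341,385582), (383518,383744),
    (383335,383549), (381053,381276), (379589,379788), (375679,375878), (372512,372693), (367218,367383),
    (357700,357838), (340934,341076), (258739,258885)]"
  and enclosure_11: "encloses 1000000 11 70 ((D0 ^^ 8) (D2 E))
   [(367019,368355), (367057,368378), (367050,368355), (367088,368287), (367111,368317), (367111,368325),
    (367118,368310), (367095,368317), (367126,368256), (367111,368317), (367149,368264), (367172,368241),
    (367149,368256), (367172,368203), (367172,368218), (367195,368180), (367233,368195), (367233,368195),
    (367286,368226), (367279,368172), (367309,368218), (367309,368233), (367355,368264), (367385,368233),
    (367385,368210), (367362,368203), (367080,367905), (366996,367806), (366813,367585), (366806,367524),
    (366600,367379), (366699,367371), (366630,367302), (366867,367539), (367034,367707), (367805,368416),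
    (368873,369484), (375526,376084), (373802,374337), (373947,374466), (371833,372353), (371238,371712),
    (367820,368264), (366127,366570), (361495,361901), (357261,357644), (346580,346978), (331573,331933),
    (251396,251786)]"
  and enclosure_12: "encloses 1000000 12 70 ((D0 ^^ 9) (D2 E))
   [(361001,361361), (361007,361361), (361015,361350), (361009,361352), (361009,361338), (361013,361348),
    (361013,361340), (361017,361338), (361019,361332), (361021,361332), (361032,361327), (361042,361321),
    (361045,361338), (361059,361342), (361082,361355), (361083,361361), (361110,361382), (361125,361386),
    (361143,361403), (361143,361403), (361152,361399), (361116,361361), (360866,361100), (360774,361010),
    (360595,360825), (360557,360781), (360404,360623), (360420,360632), (360383,360587), (360494,360684),
    (360584,360774), (360946,361130), (361503,361689), (362764,362944), (368803,368975), (367359,367528),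
    (367403,367564), (365839,365986), (365135,365286), (362714,362860), (360450,360577), (357730,357865),
    (354507,354630), (348541,348654), (339286,339385), (323362,323466), (246137,246243)]"
  and enclosure_13: "encloses 1000000 13 70 ((D0 ^^ 10) (D1 E))
   [(353851,354060), (353854,354060), (353853,354054), (353851,354051), (353857,354049), (353859,354044),
    (353863,354051), (353875,354061), (353878,354064), (353899,354073), (353906,354083), (353924,354099),
    (353934,354101), (353950,354120), (353958,354121), (353972,354134), (353958,354117), (353936,354089),
    (353703,353860), (353628,353785), (353454,353603), (353429,353577), (353278,353420), (353293,353433),
    (353200,353343), (353309,353441), (353294,353425), (353562,353686), (353748,353875), (354483,354601),
    (355519,355645), (361241,361357), (359826,359945), (360100,360210), (358565,358672), (358326,358428),
    (356085,356183), (354776,354868), (351979,352070), (350181,350264), (345396,345484), (340874,340956),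
    (330574,330649), (315985,316049), (240496,240578)]"
  and enclosure_14: "encloses 1000000 14 70 ((D0 ^^ 10) (D1 E))
   [(348443,348651), (348444,348650), (348455,348656), (348459,348657), (348475,348668), (348483,348675),
    (348500,348687), (348509,348695), (348521,348704), (348529,348709), (348542,348725), (348546,348719),
    (348545,348718), (348506,348681), (348305,348473), (348228,348398), (348085,348256), (348047,348205),
    (347914,348074), (347899,348052), (347836,347980), (347871,348020), (347876,348020), (348013,348156),
    (348135,348284), (348519,348656), (349088,349217), (350232,350365), (355509,355633), (354325,354447),
    (354472,354598), (353312,353429), (353031,353140), (351318,351428), (350037,350144), (347754,347856),
    (345936,346031), (343135,343230), (339318,339400), (333658,333746), (324476,324554), (309267,309342),
    (236140,236230)]"
  and enclosure_15: "encloses 1000000 15 70 ((D0 ^^ 10) (D1 E))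
   [(342480,342707), (342494,342715), (342498,342721), (342516,342729), (342523,342732), (342538,342751),
    (342538,342749), (342541,342758), (342534,342738), (342512,342714), (342324,342522), (342262,342454),
    (342124,342313), (342096,342286), (341965,342148), (341960,342136), (341867,342045), (341912,342083),
    (341865,342043), (341989,342155), (342006,342173), (342287,342455), (342535,342696), (343214,343380),
    (344180,344346), (349220,349373), (348048,348204), (348367,348515), (347196,347339), (347158,347295),
    (345541,345675), (344849,344982), (342621,342750), (341507,341630), (338740,338856), (336853,336964),
    (331974,332085), (327206,327304), (317369,317471), (303254,303346), (231494,231605)]"
  and enclosure_16: "encloses 1000000 16 70 ((D0 ^^ 10) (D1 E))
   [(338027,338268), (338032,338268), (338040,338276), (338039,338272), (338034,338263), (338006,338233),
    (337838,338061), (337775,337998), (337654,337874), (337615,337836), (337506,337719), (337486,337691),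
    (337407,337609), (337417,337618), (337381,337578), (337450,337642), (337475,337671), (337624,337814),
    (337807,337997), (338167,338354), (338728,338913), (339795,339976), (344476,344654), (343472,343648),
    (343704,343873), (342777,342944), (342668,342829), (341425,341577), (340650,340812), (339057,339208),
    (337553,337692), (335640,335787), (333776,333908), (330848,330988), (326827,326949), (321343,321468),
    (312254,312369), (297646,297761), (227914,228049)]"
  by (simp_all only: dp_rules) simp_all

lemma
  shows enclosure_17: "encloses 1000000 17 70 ((D0 ^^ 10) (D2 E))
   [(332968,333116), (332948,333094), (332790,332934), (332739,332881), (332620,332761), (332593,332730),
    (332481,332617), (332468,332600), (332378,332510), (332392,332523), (332334,332464), (332399,332522),
    (332372,332499), (332509,332633), (332570,332693), (332842,332963), (333104,333228), (333762,333878),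
    (334662,334784), (339170,339286), (338171,338282), (338499,338612), (337576,337683), (337657,337758),
    (336412,336519), (336000,336101), (334466,334567), (333498,333596), (331512,331613), (330370,330458),
    (327642,327734), (325463,325546), (320636,320720), (315907,315985), (306309,306387), (292635,292704),
    (224015,224104)]"
  and enclosure_18: "encloses 1000000 18 70 ((D0 ^^ 10) (D2 E))
   [(328744,328898), (328713,328861), (328615,328760), (328588,328733), (328516,328658), (328508,328647),
    (328462,328597), (328493,328625), (328480,328615), (328559,328687), (328609,328743), (328768,328897),
    (328956,329091), (329321,329446), (329859,329991), (330845,330969), (335060,335181), (334193,334317),
    (334448,334567), (333708,333819), (333708,333826), (332726,332834), (332254,332356), (331075,331185),
    (330124,330232), (328416,328515), (327191,327291), (325358,325458), (323374,323459), (320350,320440),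
    (316214,316298), (310854,310936), (301976,302050), (287909,287991), (220935,221034)]"
  and enclosure_19: "encloses 1000000 19 70 ((D0 ^^ 10) (D2 E))
   [(324189,324361), (324185,324361), (324122,324298), (324155,324324), (324117,324286), (324193,324358),
    (324199,324369), (324334,324495), (324415,324581), (324699,324862), (324964,325130), (325585,325744),
    (326441,326601), (330515,330671), (329643,329802), (329989,330142), (329219,329377), (329354,329507),
    (328383,328527), (328126,328263), (326951,327092), (326373,326510), (324698,324840), (323897,324026),
    (321991,322119), (320749,320871), (318055,318177), (315643,315759), (310890,311002), (306227,306334),
    (296868,296973), (283569,283668), (217624,217756)]"
  and enclosure_20: "encloses 1000000 20 70 ((D0 ^^ 10) (D1 E))
   [(320657,321003), (320702,321045), (320714,321056), (320795,321139), (320870,321213), (321035,321371),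
    (321239,321579), (321589,321927), (322123,322446), (323028,323359), (326873,327189), (326117,326428),
    (326386,326703), (325766,326076), (325843,326145), (325039,325334), (324746,325045), (323843,324145),
    (323195,323498), (321927,322213), (320835,321095), (319475,319747), (318221,318474), (316355,316616),
    (314169,314411), (311137,311390), (307027,307255), (301780,302022), (293040,293257), (279458,279676),
    (214934,215218)]"
  by (simp_all only: dp_rules) simp_all

lemma
  shows enclosure_21: "encloses 1000000 21 70 ((D0 ^^ 11) (D1 E))
   [(317063,317181), (317207,317323), (317305,317423), (317584,317699), (317852,317968), (318439,318553),
    (319245,319361), (322977,323084), (322200,322312), (322541,322652), (321901,322007), (322065,322173),
    (321263,321367), (321125,321223), (320198,320301), (319805,319905), (318542,318640), (317823,317923),
    (316378,316476), (315527,315614), (313683,313773), (312406,312492), (309556,309639), (307095,307174),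
    (302455,302537), (297776,297847), (288691,288766), (275760,275829), (212073,212166)]"
  and enclosure_22: "encloses 1000000 22 70 ((D0 ^^ 11) (D2 E))
   [(314611,314679), (314949,315018), (315452,315522), (316314,316380), (319845,319910), (319157,319223),
    (319437,319502), (318905,318970), (319017,319082), (318359,318418), (318162,318222), (317433,317490),
    (317000,317058), (315993,316052), (315232,315290), (313965,314019), (313061,313115), (311742,311796),
    (310370,310421), (308488,308539), (306188,306235), (303184,303232), (299056,299100), (293955,293999),
    (285376,285416), (272186,272229), (209747,209803)]"
  and enclosure_23: "encloses 1000000 23 70 ((D0 ^^ 11) (D2 E))
   [(312866,312950), (316313,316393), (315617,315698), (315944,316026), (315395,315475), (315590,315666),
    (314908,314986), (314842,314919), (314097,314171), (313824,313899), (312829,312903), (312343,312413),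
    (311036,311111), (310422,310492), (309042,309110), (308134,308199), (306306,306372), (304863,304924),
    (302031,302094), (299521,299578), (294987,295044), (290337,290390), (281475,281531), (268882,268932),
    (207195,207268)]"
  by (simp_all only: dp_rules) simp_all

lemma
  shows enclosure_24: "encloses 1000000 24 70 ((D0 ^^ 11) (D1 E))
   [(313135,313301), (312676,312834), (312816,312980), (312251,312409), (312139,312293), (311535,311691),
    (311226,311377), (310427,310579), (309880,310038), (308871,309023), (308021,308160), (306989,307134),
    (306057,306194), (304699,304833), (303356,303486), (301353,301488), (298966,299084), (296026,296155),
    (291958,292075), (286899,287018), (278512,278622), (265702,265816), (205110,205261)]"
  and enclosure_25: "encloses 1000000 25 70 ((D0 ^^ 9) (D1 E))
   [(308467,310666), (308441,310586), (307853,310010), (307662,309811), (306892,309048), (306522,308636),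
    (305541,307702), (304946,307038), (303855,305939), (303211,305222), (301853,303917), (300933,302910),
    (299083,301209), (297550,299504), (294757,296891), (292205,294209), (287780,289891), (283176,285119),
    (274543,276581), (262229,264145), (202590,205319)]"
  by (simp_all only: dp_rules) simp_all

lemma
  shows enclosure_26: "encloses 1000000 26 70 ((D0 ^^ 9) (D1 E))
   [(305225,307583), (304588,306992), (304203,306599), (303421,305756), (302791,305108), (301807,304097),
    (301067,303357), (300090,302399), (299095,301335), (297779,300156), (296264,298584), (294322,296742),
    (291915,294167), (289039,291371), (284976,287118), (280040,282364), (271804,273949), (259361,261567),
    (200691,203709)]"
  and enclosure_27: "encloses 1000000 27 70 ((D0 ^^ 9) (D1 E))
   [(300750,303502), (300331,303036), (299362,302094), (298812,301449), (297752,300450), (297080,299683),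
    (295742,298462), (294742,297402), (292877,295693), (291259,293946), (288494,291356), (285976,288666),
    (281623,284344), (277038,279667), (268638,271355), (256603,259194), (198635,202282)]"
  by (simp_all only: dp_rules) simp_all

lemma
  shows enclosure_28: "encloses 1000000 28 70 ((D0 ^^ 9) (D2 E))
   [(297195,298869), (296377,298039), (295654,297293), (294618,296330), (293617,295241), (292266,293997),
    (290685,292342), (288722,290465), (286306,287940), (283456,285166), (279439,281048), (274587,276244),
    (266498,268034), (254341,255953), (197078,199353)]"
  and enclosure_29: "encloses 1000000 29 70 ((D0 ^^ 9) (D2 E))
   [(292596,294587), (291902,293839), (290557,292588), (289499,291449), (287574,289639), (285945,287903),
    (283212,285252), (280694,282643), (276399,278409), (271881,273741), (263628,265606), (251865,253741),
    (195207,197989)]"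
  by (simp_all only: dp_rules) simp_all

lemma
  shows enclosure_30: "encloses 1000000 30 70 ((D0 ^^ 9) (D2 E))
   [(288276,290421), (286840,289147), (285242,287451), (283300,285607), (280843,283019), (278079,280318),
    (274072,276198), (269294,271500), (261375,263424), (249505,251652), (193643,196759)]"
  and enclosure_31: "encloses 1000000 31 70 ((D0 ^^ 9) (D2 E))
   [(282371,285079), (280723,283293), (278034,280720), (275510,278063), (271284,273919), (266824,269354),
    (258731,261328), (247220,249697), (191938,195622)]"
  by (simp_all only: dp_rules) simp_all

lemma
  shows enclosure_32: "encloses 1000000 32 70 ((D0 ^^ 9) (D2 E))
   [(275825,278697), (273082,276070), (269100,271924), (264434,267367), (256633,259484), (245021,247927),
    (190505,194554)]"
  by (simp_all only: dp_rules) simp_all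

lemma
  shows enclosure_33: "encloses 1000000 33 70 ((D0 ^^ 9) (D1 E))
   [(265811,271649), (261363,267193), (253467,259423), (242229,248139), (188667,196694)]"
  by (simp_all only: dp_rules) simp_all

lemma
  shows enclosure_34: "encloses 1000000 34 70 ((D0 ^^ 9) (D1 E))
   [(251388,257939), (240097,246697), (187301,196198)]"
  by (simp_all only: dp_rules) simp_all

lemma
  shows enclosure_35: "encloses 1000000 35 70 ((D0 ^^ 7) (D2 E))
   [(182006,219697)]"
  by (simp_all only: dp_rules) simp_all

text \<open>
  For the two close pairs the program is run again with a finer unit, starting from exactly \<open>n\<close> points.
\<close>

lemma
  shows enclosure_58_19: "encloses 100000000 19 58 ((D0 ^^ 15) (D1 E))
   [(32649705,32649749)]"
  and enclosure_58_20: "encloses 100000000 20 58 ((D0 ^^ 15) (D1 E))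
   [(32649643,32649685)]"
  and enclosure_62_20: "encloses 100000000 20 62 ((D0 ^^ 13) (D2 E))
   [(32224069,32224413)]"
  and enclosure_62_21: "encloses 100000000 21 62 ((D0 ^^ 14) (D1 E))
   [(32223607,32223832)]"
  by (simp_all only: dp_rules) simp_all

section \<open>Comparing neighbouring proportions\<close>

definition exceptions :: "(nat \<times> nat) set" where
  "exceptions = {(30,9), (36,11), (39,12), (42,13), (45,14), (47,15), (48,15),
              (51,16), (53,17), (54,17), (57,18), (59,19), (60,19), (63,20),
              (64,21), (65,21), (66,21), (68,22), (69,22), (70,23)}"

text \<open>
  The pairs for which bounds to six decimal places do not suffice.
\<close>

definition tight :: "(nat \<times> nat) set" where
  "tight = {(58,19), (62,20)}"

fun separated :: "nat \<Rightarrow> nat \<Rightarrow> (int \<times> int) list \<Rightarrow> (int \<times> int) list \<Rightarrow> bool" where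
  "separated k n ((l, u) # bs) ((l', u') # bs') \<longleftrightarrow>
     (if (n, k) \<in> exceptions then u < l' else (n, k) \<in> tight \<or> u' \<le> l) \<and> separated k (n - 1) bs bs'"
| "separated k n bs [] \<longleftrightarrow> True"
| "separated k n [] bs' \<longleftrightarrow> False"

lemma separated_nth:
  assumes "separated k n bs bs'" "e < length bs'"
  shows "e < length bs \<and> (if (n - e, k) \<in> exceptions then snd (bs ! e) < fst (bs' ! e)
    else (n - e, k) \<in> tight \<or> snd (bs' ! e) \<le> fst (bs ! e))"
  using assms
proof (induction k n bs bs' arbitrary: e rule: separated.induct)
  case (1 k n l u bs l' u' bs')
  show ?case
  proof (cases e)
    case 0 thus ?thesis using 1 by (auto split: if_splits)
  next
    case (Suc e')
    hence "separated k (n - 1) bs bs'" "e' < length bs'" using 1(2,3) by auto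
    note IH = 1(1)[OF this]
    have "n - 1 - e' = n - e" using Suc by simp
    from IH[unfolded this, unfolded Suc] show ?thesis unfolding Suc by simp
  qed
qed auto

lemma compare_enclosures:
  assumes "encloses D k N x bs" "encloses D (Suc k) N y bs'" "separated k N bs bs'"
    and "0 < k" "k < 70" "0 < D" "0 < qval x" "0 < qval y"
    and "e < length bs'" "e \<le> N" "(N - e, k) \<notin> tight"
  shows "i_prop (N - e) k < i_prop (N - e) (Suc k) \<longleftrightarrow> (N - e, k) \<in> exceptions"
proof -
  note S = separated_nth[OF assms(3,9)]
  obtain l u l' u' where b: "bs ! e = (l, u)" "bs' ! e = (l', u')" by (metis surj_pair)
  have "0 < Suc k" "k \<le> 70" "Suc k \<le> 70" "e < length bs" using assms(5) S by auto
  note i = i_prop_bounds[OF assms(1)[unfolded encloses_def] assms(4) this(2) assms(10) this(4) b(1) assms(6,7)]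
    i_prop_bounds[OF assms(2)[unfolded encloses_def] this(1) this(3) assms(10,9) b(2) assms(6,8)]
  have D: "0 < (of_int D :: real)" using assms(6) by simp
  show ?thesis
  proof (cases "(N - e, k) \<in> exceptions")
    case True
    hence "u < l'" using S b by simp
    hence "(of_int u :: real) / of_int D < of_int l' / of_int D" using D by (simp add: divide_strict_right_mono)
    thus ?thesis using True i by linarith
  next
    case False
    hence "u' \<le> l" using S b assms(11) by simp
    hence "(of_int u' :: real) / of_int D \<le> of_int l / of_int D" using D by (simp add: divide_right_mono)
    thus ?thesis using False i by linarith
  qed
qed

definition ordered :: "nat \<Rightarrow> bool" where
  "ordered k \<longleftrightarrow> (\<forall>n. 2 * k + 2 \<le> n \<longrightarrow> n \<le> 70 \<longrightarrow> (n, k) \<notin> tight \<longrightarrow>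
     (i_prop n k < i_prop n (Suc k) \<longleftrightarrow> (n, k) \<in> exceptions))"

lemma orderedI:
  assumes "encloses D k 70 x bs" "encloses D k' 70 y bs'" "k' = Suc k" "separated k 70 bs bs'"
    and "0 < k" "k < 70" "0 < D" "0 < qval x" "0 < qval y" "length bs' + 2 * k = 69"
  shows "ordered k"
  unfolding ordered_def
proof (intro allI impI)
  fix n assume n: "2 * k + 2 \<le> n" "n \<le> 70" "(n, k) \<notin> tight"
  have "70 - n < length bs'" "70 - n \<le> 70" "70 - (70 - n) = n" using n assms(10) by auto
  thus "i_prop n k < i_prop n (Suc k) \<longleftrightarrow> (n, k) \<in> exceptions"
    using compare_enclosures[OF assms(1) assms(2)[unfolded assms(3)] assms(4-9), of "70 - n"] n(3) by simp
qed

lemma ordered_all: assumes "0 < k" "k < 35" shows "ordered k"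
proof -
  have o1: "ordered 1" by (rule orderedI[OF enclosure_1 enclosure_2]) (simp_all add: exceptions_def tight_def qval_shift)
  have o2: "ordered 2" by (rule orderedI[OF enclosure_2 enclosure_3]) (simp_all add: exceptions_def tight_def qval_shift)
  have o3: "ordered 3" by (rule orderedI[OF enclosure_3 enclosure_4]) (simp_all add: exceptions_def tight_def qval_shift)
  have o4: "ordered 4" by (rule orderedI[OF enclosure_4 enclosure_5]) (simp_all add: exceptions_def tight_def qval_shift)
  have o5: "ordered 5" by (rule orderedI[OF enclosure_5 enclosure_6]) (simp_all add: exceptions_def tight_def qval_shift)
  have o6: "ordered 6" by (rule orderedI[OF enclosure_6 enclosure_7]) (simp_all add: exceptions_def tight_def qval_shift)
  have o7: "ordered 7" by (rule orderedI[OF enclosure_7 enclosure_8]) (simp_all add: exceptions_def tight_def qval_shift)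
  have o8: "ordered 8" by (rule orderedI[OF enclosure_8 enclosure_9]) (simp_all add: exceptions_def tight_def qval_shift)
  have o9: "ordered 9" by (rule orderedI[OF enclosure_9 enclosure_10]) (simp_all add: exceptions_def tight_def qval_shift)
  have o10: "ordered 10" by (rule orderedI[OF enclosure_10 enclosure_11]) (simp_all add: exceptions_def tight_def qval_shift)
  have o11: "ordered 11" by (rule orderedI[OF enclosure_11 enclosure_12]) (simp_all add: exceptions_def tight_def qval_shift)
  have o12: "ordered 12" by (rule orderedI[OF enclosure_12 enclosure_13]) (simp_all add: exceptions_def tight_def qval_shift)
  have o13: "ordered 13" by (rule orderedI[OF enclosure_13 enclosure_14]) (simp_all add: exceptions_def tight_def qval_shift)
  have o14: "ordered 14" by (rule orderedI[OF enclosure_14 enclosure_15]) (simp_all add: exceptions_def tight_def qval_shift)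
  have o15: "ordered 15" by (rule orderedI[OF enclosure_15 enclosure_16]) (simp_all add: exceptions_def tight_def qval_shift)
  have o16: "ordered 16" by (rule orderedI[OF enclosure_16 enclosure_17]) (simp_all add: exceptions_def tight_def qval_shift)
  have o17: "ordered 17" by (rule orderedI[OF enclosure_17 enclosure_18]) (simp_all add: exceptions_def tight_def qval_shift)
  have o18: "ordered 18" by (rule orderedI[OF enclosure_18 enclosure_19]) (simp_all add: exceptions_def tight_def qval_shift)
  have o19: "ordered 19" by (rule orderedI[OF enclosure_19 enclosure_20]) (simp_all add: exceptions_def tight_def qval_shift)
  have o20: "ordered 20" by (rule orderedI[OF enclosure_20 enclosure_21]) (simp_all add: exceptions_def tight_def qval_shift)
  have o21: "ordered 21" by (rule orderedI[OF enclosure_21 enclosure_22]) (simp_all add: exceptions_def tight_def qval_shift)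
  have o22: "ordered 22" by (rule orderedI[OF enclosure_22 enclosure_23]) (simp_all add: exceptions_def tight_def qval_shift)
  have o23: "ordered 23" by (rule orderedI[OF enclosure_23 enclosure_24]) (simp_all add: exceptions_def tight_def qval_shift)
  have o24: "ordered 24" by (rule orderedI[OF enclosure_24 enclosure_25]) (simp_all add: exceptions_def tight_def qval_shift)
  have o25: "ordered 25" by (rule orderedI[OF enclosure_25 enclosure_26]) (simp_all add: exceptions_def tight_def qval_shift)
  have o26: "ordered 26" by (rule orderedI[OF enclosure_26 enclosure_27]) (simp_all add: exceptions_def tight_def qval_shift)
  have o27: "ordered 27" by (rule orderedI[OF enclosure_27 enclosure_28]) (simp_all add: exceptions_def tight_def qval_shift)
  have o28: "ordered 28" by (rule orderedI[OF enclosure_28 enclosure_29]) (simp_all add: exceptions_def tight_def qval_shift)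
  have o29: "ordered 29" by (rule orderedI[OF enclosure_29 enclosure_30]) (simp_all add: exceptions_def tight_def qval_shift)
  have o30: "ordered 30" by (rule orderedI[OF enclosure_30 enclosure_31]) (simp_all add: exceptions_def tight_def qval_shift)
  have o31: "ordered 31" by (rule orderedI[OF enclosure_31 enclosure_32]) (simp_all add: exceptions_def tight_def qval_shift)
  have o32: "ordered 32" by (rule orderedI[OF enclosure_32 enclosure_33]) (simp_all add: exceptions_def tight_def qval_shift)
  have o33: "ordered 33" by (rule orderedI[OF enclosure_33 enclosure_34]) (simp_all add: exceptions_def tight_def qval_shift)
  have o34: "ordered 34" by (rule orderedI[OF enclosure_34 enclosure_35]) (simp_all add: exceptions_def tight_def qval_shift)
  have "k \<in> set [1..<35]" using assms by simp
  also have "[1..<35] = [1,2,3,4,5,6,7,8,9,10,11,12,13,14,15,16,17,18,19,20,21,22,23,24,25,26,27,28,29,30,31,32,33,34]" by code_simp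
  finally show ?thesis using o1 o2 o3 o4 o5 o6 o7 o8 o9 o10 o11 o12 o13 o14 o15 o16 o17 o18 o19 o20 o21 o22 o23 o24 o25 o26 o27 o28 o29 o30 o31 o32 o33 o34 by auto
qed

lemma tight_pairs:
  "\<not> i_prop 58 19 < i_prop 58 20" "\<not> i_prop 62 20 < i_prop 62 21"
proof -
  note b = i_prop_bounds[where e = 0, OF _ _ _ _ _ nth_Cons_0]
  have "i_prop 58 20 \<le> 32649685 / 100000000" "32649705 / 100000000 \<le> i_prop 58 19"
    using b(2)[OF enclosure_58_20[unfolded encloses_def]] b(1)[OF enclosure_58_19[unfolded encloses_def]]
    by (simp_all add: qval_shift)
  thus "\<not> i_prop 58 19 < i_prop 58 20" by simp
  have "i_prop 62 21 \<le> 32223832 / 100000000" "32224069 / 100000000 \<le> i_prop 62 20"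
    using b(2)[OF enclosure_62_21[unfolded encloses_def]] b(1)[OF enclosure_62_20[unfolded encloses_def]]
    by (simp_all add: qval_shift)
  thus "\<not> i_prop 62 20 < i_prop 62 21" by simp
qed

theorem mainTheorem2:
  fixes n k :: nat
  assumes "n > 0" and "k > 0" and "2 * k < n" and "n \<le> 70"
  shows "i_prop n k < i_prop n (k + 1) \<longleftrightarrow>
    (n, k) \<in> {(30,9), (36,11), (39,12), (42,13), (45,14), (47,15), (48,15),
              (51,16), (53,17), (54,17), (57,18), (59,19), (60,19), (63,20),
              (64,21), (65,21), (66,21), (68,22), (69,22), (70,23)}"
proof -
  have "i_prop n k < i_prop n (k + 1) \<longleftrightarrow> (n, k) \<in> exceptions"
  proof (cases "n = 2 * k + 1")
    case True
    hence "i_prop n k = i_prop n (k + 1)" using i_prop_complement[of k n] by simp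
    moreover have "(n, k) \<notin> exceptions" using True by (auto simp: exceptions_def)
    ultimately show ?thesis by simp
  next
    case False
    show ?thesis
    proof (cases "(n, k) \<in> tight")
      case True
      hence "n = 58 \<and> k = 19 \<or> n = 62 \<and> k = 20" by (simp add: tight_def)
      moreover have "(58, 19) \<notin> exceptions" "(62, 20) \<notin> exceptions" by (simp_all add: exceptions_def)
      ultimately show ?thesis using tight_pairs by (elim disjE conjE) simp_all
    next
      case not_tight: False
      have "ordered k" using assms False by (intro ordered_all) auto
      thus ?thesis using assms False not_tight by (simp add: ordered_def)
    qed
  qed
  thus ?thesis by (simp only: exceptions_def)
qed

end
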